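(* Let $f:\mathbb{R}^d\to\mathbb{R}$ be convex and $L_0$-Lipschitz continuous, with minimizer $x^*$. Run the deterministic one-point residual feedback algorithm from $x_1$ for $T$ iterations with $\alpha=\sqrt{d/T}$ and $\eta=\frac{1}{3\sqrt{dT}L_0}$. Then $$\frac1T\sum_{t=1}^T\mathbb{E}\big[f(x_t)-f(x^* )\big]\le\frac{3\|x_1-x^*\|^2d^{1/2}L_0}{T^{1/2}}+\frac{4c_0L_0d^{1/2}}{T^{1/2}}+\frac{d^{1/2}L_0}{T^{1/2}} .$$
   Context: $\|\cdot\|$ is the Euclidean norm on $\mathbb{R}^d$, $d\ge1$. A function $f$ is $L_0$-Lipschitz continuous ($L_0>0$) if $|f(x)-f(y)|\le L_0\|x-y\|$ for all $x,y$. $x^*$ denotes a minimizer of $f$ over $\mathbb{R}^d$. $c_0>0$ is a fixed universal numerical constant such that for every $d\ge1$, every $M>0$ and every $M$-Lipschitz function $h:\mathbb{R}^d\to\mathbb{R}$, if $u$ is uniformly distributed on the Euclidean unit sphere of $\mathbb{R}^d$ then $\sqrt{\mathbb{E}[(h(u)-\mathbb{E}[h(u)])^4]}\le c_0M^2/d$. Deterministic one-point residual feedback algorithm: given an initial point $x_1\in\mathbb{R}^d$, step size $\eta>0$, smoothing parameter $\alpha>0$ and iteration number $T$, set $x_0=x_1$, let $u_0,u_1,\dots,u_T$ be independent and uniformly distributed on the unit sphere of $\mathbb{R}^d$, and for $t=1,\dots,T$ put $$g_t=d\cdot\frac{f(x_t+\alpha u_t)-f(x_{t-1}+\alpha u_{t-1})}{\alpha}\,u_t,\qquad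 x_{t+1}=x_t-\eta g_t .$$ Expectations are over all the $u_t$. *)

theory Defs
  imports "HOL-Probability.Probability"
begin

(* The library has no surface measure.  The uniform distribution on the unit sphere is taken to be
   the law of the radial projection x / norm x of a uniformly distributed point x of the unit ball;
   the lemmas prob_space_uniform_sphere, AE_uniform_sphere and uniform_sphere_orthogonal_invariant
   below show that it is a rotation invariant probability measure carried by the sphere. *)
definition uniform_sphere :: "'a::euclidean_space measure" where
  "uniform_sphere = distr (uniform_measure lborel (cball 0 1)) borel (\<lambda>x. x /\<^sub>R norm x)"

(* A type of vectors fixes the dimension, so a condition that ranges over all dimensions d uses
   coordinate vectors indexed by {..<d} instead; L2_set x {..<d} is the Euclidean norm there. *)
definition lborel_coords :: "nat \<Rightarrow> (nat \<Rightarrow> real) measure" where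
  "lborel_coords d = (\<Pi>\<^sub>M i\<in>{..<d}. lborel)"

definition uniform_sphere_coords :: "nat \<Rightarrow> (nat \<Rightarrow> real) measure" where
  "uniform_sphere_coords d =
     distr (uniform_measure (lborel_coords d) {x \<in> space (lborel_coords d). L2_set x {..<d} \<le> 1})
       (lborel_coords d) (\<lambda>x. \<lambda>i\<in>{..<d}. x i / L2_set x {..<d})"

definition sphere_fourth_moment_constant :: "real \<Rightarrow> bool" where
  "sphere_fourth_moment_constant c \<longleftrightarrow> c > 0 \<and>
     (\<forall>d\<ge>1. \<forall>M>0. \<forall>h :: (nat \<Rightarrow> real) \<Rightarrow> real.
        (\<forall>x \<in> {..<d} \<rightarrow>\<^sub>E UNIV. \<forall>y \<in> {..<d} \<rightarrow>\<^sub>E UNIV.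
            \<bar>h x - h y\<bar> \<le> M * L2_set (\<lambda>i. x i - y i) {..<d}) \<longrightarrow>
        sqrt (\<integral>u. (h u - (\<integral>v. h v \<partial>uniform_sphere_coords d)) ^ 4 \<partial>uniform_sphere_coords d)
          \<le> c * M\<^sup>2 / real d)"

(* The gradient estimate at x with direction u, where x' and u' are the previous ones. *)
definition residual_gradient ::
    "((real^'n) \<Rightarrow> real) \<Rightarrow> real \<Rightarrow> real^'n \<Rightarrow> real^'n \<Rightarrow> real^'n \<Rightarrow> real^'n \<Rightarrow> real^'n" where
  "residual_gradient f \<alpha> x u x' u' =
     (real CARD('n) * ((f (x + \<alpha> *\<^sub>R u) - f (x' + \<alpha> *\<^sub>R u')) / \<alpha>)) *\<^sub>R u"

fun residual_iterate ::
    "((real^'n) \<Rightarrow> real) \<Rightarrow> real \<Rightarrow> real \<Rightarrow> real^'n \<Rightarrow> (nat \<Rightarrow> real^'n) \<Rightarrow> nat \<Rightarrow> real^'n" where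
  "residual_iterate f \<alpha> \<eta> x1 u 0 = x1"
| "residual_iterate f \<alpha> \<eta> x1 u (Suc 0) = x1"
| "residual_iterate f \<alpha> \<eta> x1 u (Suc (Suc t)) =
     residual_iterate f \<alpha> \<eta> x1 u (Suc t) -
     \<eta> *\<^sub>R residual_gradient f \<alpha> (residual_iterate f \<alpha> \<eta> x1 u (Suc t)) (u (Suc t))
            (residual_iterate f \<alpha> \<eta> x1 u t) (u t)"

lemma emeasure_unit_cball_pos:
  "emeasure lborel (cball (0::'a::euclidean_space) 1) \<noteq> 0"
proof -
  have "emeasure lborel (ball (0::'a) 1) > 0"
    by (simp add: emeasure_ball unit_ball_vol_pos)
  also have "emeasure lborel (ball (0::'a) 1) \<le> emeasure lborel (cball (0::'a) 1)"
    by (intro emeasure_mono) auto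
  finally show ?thesis by simp
qed

lemma emeasure_unit_cball_finite:
  "emeasure lborel (cball (0::'a::euclidean_space) 1) \<noteq> \<infinity>"
  using emeasure_bounded_finite[of "cball (0::'a) 1"] by (simp add: less_top)

lemma prob_space_uniform_sphere: "prob_space (uniform_sphere :: 'a::euclidean_space measure)"
  unfolding uniform_sphere_def
  using emeasure_unit_cball_pos emeasure_unit_cball_finite
  by (intro prob_space.prob_space_distr prob_space_uniform_measure) auto

lemma AE_uniform_sphere: "AE u in (uniform_sphere :: 'a::euclidean_space measure). norm u = 1"
proof -
  have "AE x in uniform_measure lborel (cball (0::'a) 1). x \<noteq> 0"
    by (rule AE_uniform_measureI) (auto intro: AE_mp[OF AE_lborel_singleton[of 0]])
  then show ?thesis
    unfolding uniform_sphere_def by (subst AE_distr_iff) (auto elim: AE_mp)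
qed

lemma distr_uniform_measure:
  assumes T: "T \<in> measurable M N" and A: "A \<in> sets N"
  shows "distr (uniform_measure M (T -` A \<inter> space M)) N T = uniform_measure (distr M N T) A"
proof (rule measure_eqI)
  fix B assume "B \<in> sets (distr (uniform_measure M (T -` A \<inter> space M)) N T)"
  then have B: "B \<in> sets N" by simp
  have "(T -` A \<inter> space M) \<inter> (T -` B \<inter> space M) = T -` (A \<inter> B) \<inter> space M" by auto
  with T A B show "emeasure (distr (uniform_measure M (T -` A \<inter> space M)) N T) B =
      emeasure (uniform_measure (distr M N T) A) B"
    by (simp add: emeasure_distr measurable_sets)
qed simp

lemma uniform_sphere_orthogonal_invariant:
  fixes T :: "real^'n::{finite,wellorder} \<Rightarrow> real^'n::_"
  assumes T: "orthogonal_transformation T"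
  shows "distr uniform_sphere borel T = uniform_sphere"
proof -
  have lin: "linear T" and nrm: "\<And>x. norm (T x) = norm x" and bij: "bij T"
    using T orthogonal_transformation_linear orthogonal_transformation_norm
      orthogonal_transformation_bij by blast+
  have [measurable]: "T \<in> borel_measurable borel"
    using lin by (intro borel_measurable_continuous_onI linear_continuous_on)
      (simp add: linear_conv_bounded_linear)
  have L: "distr lborel borel T = lborel"
  proof (rule lborel_eqI[symmetric])
    fix l u :: "real^'n::{finite,wellorder}" assume lu: "\<And>b. b \<in> Basis \<Longrightarrow> l \<bullet> b \<le> u \<bullet> b"
    have oi: "orthogonal_transformation (inv T)"
      using T by (rule orthogonal_transformation_inv)
    have pre: "T -` box l u = inv T ` box l u"
      using bij by (simp add: bij_vimage_eq_inv_image)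
    have meas: "inv T ` box l u \<in> sets borel"
      unfolding pre[symmetric] using measurable_sets[of T borel borel "box l u"] by simp
    have bdd: "bounded (inv T ` box l u)"
      using oi by (intro bounded_linear_image)
        (auto simp: linear_conv_bounded_linear dest: orthogonal_transformation_linear)
    have "emeasure lborel (inv T ` box l u) = ennreal (measure lborel (inv T ` box l u))"
      using emeasure_bounded_finite[OF bdd] by (simp add: emeasure_eq_ennreal_measure less_top)
    also have "measure lborel (inv T ` box l u) = measure lebesgue (inv T ` box l u)"
      using meas by (simp add: measure_completion)
    also have "\<dots> = measure lebesgue (box l u)"
      by (rule measure_orthogonal_image) (use oi in auto)
    also have "\<dots> = (\<Prod>b\<in>Basis. (u - l) \<bullet> b)"
      using lu by (simp add: measure_completion)
    finally show "emeasure (distr lborel borel T) (box l u) = (\<Prod>b\<in>Basis. (u - l) \<bullet> b)"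
      by (simp add: emeasure_distr pre)
  qed simp
  have pre: "T -` cball 0 1 = cball 0 1"
    using nrm by (auto simp: dist_norm)
  have U: "distr (uniform_measure lborel (cball 0 1)) borel T = uniform_measure lborel (cball 0 1)"
    using distr_uniform_measure[of T lborel borel "cball 0 1"] by (simp add: pre L)
  have comm: "T (x /\<^sub>R norm x) = T x /\<^sub>R norm (T x)" for x
    using nrm lin by (simp add: linear_cmul)
  have "distr uniform_sphere borel T =
      distr (uniform_measure lborel (cball 0 1)) borel (\<lambda>x. T x /\<^sub>R norm (T x))"
    unfolding uniform_sphere_def by (simp add: distr_distr o_def comm[symmetric])
  also have "\<dots> = distr (distr (uniform_measure lborel (cball 0 1)) borel T) borel (\<lambda>x. x /\<^sub>R norm x)"
    by (simp add: distr_distr o_def)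
  also have "\<dots> = uniform_sphere"
    unfolding U uniform_sphere_def ..
  finally show ?thesis .
qed

(* The two models of the uniform distribution on the sphere agree. *)
lemma uniform_sphere_eq_coords:
  fixes e :: "nat \<Rightarrow> 'a::euclidean_space"
  assumes e: "bij_betw e {..<DIM('a)} Basis"
  shows "distr (uniform_sphere_coords DIM('a)) borel (\<lambda>x. \<Sum>i<DIM('a). x i *\<^sub>R e i) = uniform_sphere"
proof -
  let ?d = "DIM('a)" and ?P = "lborel_coords DIM('a)"
  define \<phi> :: "(nat \<Rightarrow> real) \<Rightarrow> 'a" where "\<phi> x = (\<Sum>i<?d. x i *\<^sub>R e i)" for x
  interpret product_sigma_finite "\<lambda>_::nat. lborel :: real measure" ..
  have spP: "space ?P = {..<?d} \<rightarrow>\<^sub>E UNIV"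
    by (simp add: lborel_coords_def space_PiM)
  have [measurable]: "(\<lambda>x. x i) \<in> borel_measurable ?P" if "i < ?d" for i
    using that unfolding lborel_coords_def
    by (metis lessThan_iff measurable_component_singleton measurable_lborel1)
  have \<phi>_meas [measurable]: "\<phi> \<in> borel_measurable ?P"
    unfolding \<phi>_def by (intro borel_measurable_sum borel_measurable_scaleR) auto
  have eB: "e i \<in> Basis" if "i < ?d" for i
    using e that by (auto simp: bij_betw_def)
  have inner: "\<phi> x \<bullet> e j = x j" if "j < ?d" for x j
  proof -
    have "\<phi> x \<bullet> e j = (\<Sum>i<?d. x i * (e i \<bullet> e j))"
      by (simp add: \<phi>_def inner_sum_left)
    also have "\<dots> = (\<Sum>i<?d. if i = j then x i else 0)"
      using e that by (intro sum.cong refl)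
        (auto simp: bij_betw_def inj_on_def inner_Basis eB)
    finally show ?thesis using that by simp
  qed
  have nrm: "norm (\<phi> x) = L2_set x {..<?d}" for x
  proof -
    have "norm (\<phi> x) = L2_set (\<lambda>b. \<phi> x \<bullet> b) Basis"
      using euclidean_dist_l2[of "\<phi> x" 0] by (simp add: dist_real_def L2_set_def)
    also have "\<dots> = sqrt (\<Sum>i<?d. (\<phi> x \<bullet> e i)\<^sup>2)"
      unfolding L2_set_def using sum.reindex_bij_betw[OF e, of "\<lambda>b. (\<phi> x \<bullet> b)\<^sup>2"] by simp
    also have "\<dots> = L2_set x {..<?d}"
      unfolding L2_set_def by (simp add: inner)
    finally show ?thesis .
  qed
  have [measurable]: "(\<lambda>x. L2_set x {..<?d}) \<in> borel_measurable ?P"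
  proof -
    have "(\<lambda>x. norm (\<phi> x)) \<in> borel_measurable ?P"
      by (rule measurable_compose[OF \<phi>_meas borel_measurable_norm])
    then show ?thesis by (simp add: nrm)
  qed
  have D: "distr ?P borel \<phi> = lborel"
  proof (rule lborel_eqI[symmetric])
    fix l u :: 'a assume lu: "\<And>b. b \<in> Basis \<Longrightarrow> l \<bullet> b \<le> u \<bullet> b"
    have "\<phi> x \<in> box l u \<longleftrightarrow> (\<forall>i<?d. l \<bullet> e i < x i \<and> x i < u \<bullet> e i)" for x
    proof -
      have "\<phi> x \<in> box l u \<longleftrightarrow> (\<forall>b\<in>e ` {..<?d}. l \<bullet> b < \<phi> x \<bullet> b \<and> \<phi> x \<bullet> b < u \<bullet> b)"
        using e by (simp add: mem_box bij_betw_def)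
      then show ?thesis by (simp add: inner lessThan_def)
    qed
    then have "\<phi> -` box l u \<inter> space ?P = (\<Pi>\<^sub>E i\<in>{..<?d}. {l \<bullet> e i<..<u \<bullet> e i})"
      by (auto simp: spP PiE_iff)
    then have "emeasure (distr ?P borel \<phi>) (box l u) =
        (\<Prod>i<?d. emeasure lborel {l \<bullet> e i<..<u \<bullet> e i})"
      by (simp add: emeasure_distr) (simp add: lborel_coords_def emeasure_PiM)
    also have "\<dots> = (\<Prod>i<?d. ennreal ((u - l) \<bullet> e i))"
      using lu eB by (intro prod.cong refl) (simp add: inner_diff_left)
    also have "\<dots> = ennreal (\<Prod>i<?d. (u - l) \<bullet> e i)"
      using lu eB by (intro prod_ennreal) (simp add: inner_diff_left)
    also have "(\<Prod>i<?d. (u - l) \<bullet> e i) = (\<Prod>b\<in>Basis. (u - l) \<bullet> b)"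
      by (rule prod.reindex_bij_betw[OF e])
    finally show "emeasure (distr ?P borel \<phi>) (box l u) = (\<Prod>b\<in>Basis. (u - l) \<bullet> b)" .
  qed simp
  have pre: "\<phi> -` cball 0 1 \<inter> space ?P = {x \<in> space ?P. L2_set x {..<?d} \<le> 1}" (is "_ = ?B")
    by (auto simp: nrm)
  have U: "distr (uniform_measure ?P ?B) borel \<phi> = uniform_measure lborel (cball 0 1)"
    using distr_uniform_measure[of \<phi> ?P borel "cball 0 1"] by (simp add: pre D)
  have comm: "\<phi> (\<lambda>i\<in>{..<?d}. x i / L2_set x {..<?d}) = \<phi> x /\<^sub>R norm (\<phi> x)" for x
    unfolding nrm by (simp add: \<phi>_def scaleR_sum_right divide_inverse mult.commute)
  have proj: "(\<lambda>x. \<lambda>i\<in>{..<?d}. x i / L2_set x {..<?d}) \<in> measurable ?P ?P"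
    apply (subst (2) lborel_coords_def)
    apply (intro measurable_restrict)
    apply simp
    done
  have "distr (uniform_sphere_coords ?d) borel \<phi> =
      distr (uniform_measure ?P ?B) borel (\<lambda>x. \<phi> x /\<^sub>R norm (\<phi> x))"
    unfolding uniform_sphere_coords_def using proj by (simp add: distr_distr o_def comm)
  also have "\<dots> = distr (distr (uniform_measure ?P ?B) borel \<phi>) borel (\<lambda>x. x /\<^sub>R norm x)"
    by (simp add: distr_distr o_def)
  also have "\<dots> = uniform_sphere"
    unfolding U uniform_sphere_def ..
  finally show ?thesis unfolding \<phi>_def .
qed

end

theory Submission
  imports Defs
begin

text \<open>
  Write \<open>d\<close> for the dimension.  The algorithm is stochastic gradient descent on a smoothing of
  \<open>f\<close>, and the bound rests on two properties of its gradient estimate.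

  The estimate points in the right direction on average.  The direction \<open>u t\<close> is independent of the
  past, so given the past the mean of \<open>g t\<close> is the sphere average of
  \<open>(d / \<alpha>) * (f (x + \<alpha> v) - c) * v\<close>, where \<open>x\<close> is the current iterate and \<open>c\<close> the previous
  function value.  By the divergence theorem this is the gradient at \<open>x\<close> of the average of \<open>f\<close> over
  the ball of radius \<open>\<alpha>\<close> around \<open>x\<close>.  That average is convex, is at least \<open>f\<close> and exceeds it by at
  most \<open>\<alpha> * L0\<close>, whence the expectation of \<open>g t \<bullet> (x t - xs)\<close> is at least that of
  \<open>f (x t) - f xs - \<alpha> * L0\<close>.  As \<open>f\<close> need not be differentiable and only the subgradient inequality
  matters, that inequality is proved directly (\<open>sphere_average_subgradient\<close>): the indicator of the
  ball is replaced by a tent function, the difference quotient is shifted from \<open>f\<close> to the tent, and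
  the width of the shell that carries the gradient of the tent tends to 0.

  The estimate is not too large.  A Lipschitz function varies little on a sphere of high dimension: the
  fourth moment hypothesis bounds the variance of \<open>f (x + \<alpha> v)\<close> by \<open>c0 * \<alpha>\<^sup>2 * L0\<^sup>2 / d\<close>.  Two such
  fluctuations and the change of the sphere average between consecutive iterates make up
  the difference in \<open>g t\<close>.  That change is controlled by the previous step, hence by the previous
  estimate, which gives a recursion for the second moments; with the chosen parameters it contracts
  by 1/3 and yields \<open>9 * c0 * d * L0\<^sup>2\<close> (\<open>second_moment_bound\<close>).

  Expanding the square of the distance to \<open>xs\<close> and summing over the rounds
  (\<open>sum_optimality_gap_le\<close>) bounds the average gap by
  \<open>(norm (x1 - xs))\<^sup>2 / (2 * \<eta> * T) + \<eta> * 9 * c0 * d * L0\<^sup>2 / 2 + \<alpha> * L0\<close>.  For the given \<open>\<eta>\<close> and \<open>\<alpha>\<close> the three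
  terms are the asserted ones, with 3/2 in place of the constants 3 and 4.
\<close>

section \<open>Integrals over balls, shells and the sphere\<close>

lemma sets_borel_cball [measurable]: "cball c r \<in> sets (borel :: 'a::euclidean_space measure)"
  by simp

lemma continuous_bounded_on_cball:
  fixes k :: "'a::euclidean_space \<Rightarrow> real"
  assumes k: "continuous_on UNIV k"
  obtains C where "\<And>z. norm z \<le> r \<Longrightarrow> \<bar>k z\<bar> \<le> C"
proof -
  have "bounded (k ` cball 0 r)"
    using continuous_on_subset[OF k] by (intro compact_imp_bounded compact_continuous_image) auto
  then show thesis
    using that by (auto simp: bounded_iff) (metis dist_0_norm mem_cball)
qed

lemma lborel_integral_translate:
  fixes g :: "'a::euclidean_space \<Rightarrow> real"
  assumes [measurable]: "g \<in> borel_measurable borel"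
  shows "(\<integral>x. g (x + c) \<partial>lborel) = (\<integral>x. g x \<partial>lborel)"
proof -
  have "(\<integral>x. g x \<partial>lborel) = (\<integral>x. g x \<partial>distr lborel borel ((+) c))"
    by (simp add: lborel_distr_plus)
  also have "\<dots> = (\<integral>x. g (x + c) \<partial>lborel)"
    by (simp add: integral_distr add.commute)
  finally show ?thesis by simp
qed

lemma lborel_integrable_translate:
  fixes g :: "'a::euclidean_space \<Rightarrow> real"
  assumes g: "integrable lborel g"
  shows "integrable lborel (\<lambda>x. g (x + c))"
proof -
  have [measurable]: "g \<in> borel_measurable borel"
    using borel_measurable_integrable[OF g] by simp
  have "integrable (distr lborel borel ((+) c)) g"
    using g by (simp add: lborel_distr_plus)
  then show ?thesis
    by (simp add: integrable_distr_eq add.commute)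
qed

lemma lborel_integral_scale:
  fixes g :: "'a::euclidean_space \<Rightarrow> real"
  assumes [measurable]: "g \<in> borel_measurable borel" and "r \<noteq> 0"
  shows "(\<integral>x. g x \<partial>lborel) = \<bar>r\<bar> ^ DIM('a) * (\<integral>x. g (r *\<^sub>R x) \<partial>lborel)"
proof -
  have "(\<integral>x. g x \<partial>lborel) =
      (\<integral>x. g x \<partial>density (distr lborel borel (\<lambda>x. 0 + r *\<^sub>R x)) (\<lambda>_. ennreal (\<bar>r\<bar> ^ DIM('a))))"
    using lborel_affine[of r "0::'a"] assms(2) by (simp add: ennreal_power)
  also have "\<dots> = \<bar>r\<bar> ^ DIM('a) * (\<integral>x. g (r *\<^sub>R x) \<partial>lborel)"
    using assms(2) by (subst integral_density) (simp_all add: integral_distr)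
  finally show ?thesis .
qed

lemma integrable_mult_indicator_cball:
  fixes g :: "'a::euclidean_space \<Rightarrow> real"
  assumes g: "continuous_on UNIV g"
  shows "integrable lborel (\<lambda>x. indicator (cball 0 r) x * g x)"
  using borel_integrable_compact[of "cball 0 r" g] continuous_on_subset[OF g] by simp

lemma measure_unit_cball_pos: "measure lborel (cball (0::'a::euclidean_space) 1) > 0"
  using emeasure_unit_cball_pos[where 'a='a] emeasure_unit_cball_finite[where 'a='a]
  by (metis emeasure_eq_ennreal_measure ennreal_0 infinity_ennreal_def zero_less_measure_iff)

lemma integral_uniform_unit_cball:
  fixes g :: "'a::euclidean_space \<Rightarrow> real"
  assumes [measurable]: "g \<in> borel_measurable borel"
  shows "(\<integral>x. g x \<partial>uniform_measure lborel (cball 0 1)) =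
    (\<integral>x. indicator (cball 0 1) x * g x \<partial>lborel) / measure lborel (cball (0::'a) 1)"
proof -
  define V where "V = measure lborel (cball (0::'a) 1)"
  have V: "V > 0" unfolding V_def by (rule measure_unit_cball_pos)
  have eV: "emeasure lborel (cball (0::'a) 1) = ennreal V"
    unfolding V_def using emeasure_unit_cball_finite[where 'a='a]
    by (intro emeasure_eq_ennreal_measure) simp
  have "uniform_measure lborel (cball (0::'a) 1) =
      density lborel (\<lambda>x. ennreal (indicator (cball 0 1) x / V))"
    unfolding uniform_measure_def eV using V
    using divide_ennreal[of 1 V]
    by (intro density_cong) (auto simp: indicator_def)
  then have "(\<integral>x. g x \<partial>uniform_measure lborel (cball 0 1)) =
      (\<integral>x. (indicator (cball 0 1) x / V) * g x \<partial>lborel)"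
    using V by (simp only:) (subst integral_density, auto)
  also have "\<dots> = (\<integral>x. (indicator (cball 0 1) x * g x) / V \<partial>lborel)"
    by (intro Bochner_Integration.integral_cong) auto
  finally show ?thesis by (simp add: V_def)
qed

lemma integral_uniform_sphere_eq_cball:
  fixes k :: "'a::euclidean_space \<Rightarrow> real"
  assumes [measurable]: "k \<in> borel_measurable borel"
  shows "(\<integral>u. k u \<partial>uniform_sphere) =
    (\<integral>x. indicator (cball 0 1) x * k (x /\<^sub>R norm x) \<partial>lborel) / measure lborel (cball (0::'a) 1)"
  unfolding uniform_sphere_def
  by (simp add: integral_distr integral_uniform_unit_cball)

text \<open>
  The integrand sees only the direction of a point, so scaling the ball back to the unit ball costs
  exactly the Jacobian.  This identity takes the place of polar coordinates.
\<close>
lemma integral_cball_radial_projection: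
  fixes k :: "'a::euclidean_space \<Rightarrow> real"
  assumes [measurable]: "k \<in> borel_measurable borel" and r: "r > 0"
  shows "(\<integral>x. indicator (cball 0 r) x * k (x /\<^sub>R norm x) \<partial>lborel) =
    r ^ DIM('a) * measure lborel (cball (0::'a) 1) * (\<integral>u. k u \<partial>uniform_sphere)"
proof -
  have "(\<integral>x. indicator (cball 0 r) x * k (x /\<^sub>R norm x) \<partial>lborel) =
      \<bar>r\<bar> ^ DIM('a) * (\<integral>x. indicator (cball 0 r) (r *\<^sub>R x) *
        k ((r *\<^sub>R x) /\<^sub>R norm (r *\<^sub>R x)) \<partial>(lborel :: 'a measure))"
    by (rule lborel_integral_scale) (use r in auto)
  also have "(\<lambda>x::'a. indicator (cball 0 r) (r *\<^sub>R x) * k ((r *\<^sub>R x) /\<^sub>R norm (r *\<^sub>R x))) =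
      (\<lambda>x. indicator (cball 0 1) x * k (x /\<^sub>R norm x))"
    using r by (auto simp: indicator_def fun_eq_iff field_simps)
  finally show ?thesis
    using r measure_unit_cball_pos[where 'a='a] by (simp add: integral_uniform_sphere_eq_cball)
qed

text \<open>
  Divided by \<open>e\<close>, the factor \<open>(1 + e) ^ DIM('a) - 1\<close> tends to the dimension as the shell gets thin.
  This is how the dimension enters the gradient estimate.
\<close>
lemma integral_shell_radial_projection:
  fixes k :: "'a::euclidean_space \<Rightarrow> real"
  assumes k: "continuous_on UNIV k" and e: "e > 0"
  shows "integrable lborel (\<lambda>x. indicator (cball 0 (1 + e) - cball 0 1) x * k (x /\<^sub>R norm x))"
    and "(\<integral>x. indicator (cball 0 (1 + e) - cball 0 1) x * k (x /\<^sub>R norm x) \<partial>lborel) =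
      ((1 + e) ^ DIM('a) - 1) * measure lborel (cball (0::'a) 1) * (\<integral>u. k u \<partial>uniform_sphere)"
proof -
  have [measurable]: "k \<in> borel_measurable borel"
    using k by (rule borel_measurable_continuous_onI)
  obtain C where C: "\<And>u. norm u \<le> 1 \<Longrightarrow> \<bar>k u\<bar> \<le> C"
    using continuous_bounded_on_cball[OF k, of 1] by blast
  have "norm (x /\<^sub>R norm x) \<le> 1" for x :: 'a by (cases "x = 0") auto
  then have Cx: "\<bar>k (x /\<^sub>R norm x)\<bar> \<le> C" for x by (rule C)
  have int: "integrable lborel (\<lambda>x. indicator (cball 0 r) x * k (x /\<^sub>R norm x))" for r
    by (rule integrableI_bounded_set[where A="cball 0 r" and B=C])
      (auto simp: indicator_def emeasure_bounded_finite[unfolded infinity_ennreal_def] intro!: Cx AE_I2)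
  have eq: "indicator (cball 0 (1 + e) - cball 0 1) x * k (x /\<^sub>R norm x) =
      indicator (cball 0 (1 + e)) x * k (x /\<^sub>R norm x) - indicator (cball 0 1) x * k (x /\<^sub>R norm x)"
    for x :: 'a
    using e by (auto simp: indicator_def)
  show "integrable lborel (\<lambda>x. indicator (cball 0 (1 + e) - cball 0 1) x * k (x /\<^sub>R norm x))"
    unfolding eq by (intro Bochner_Integration.integrable_diff int)
  show "(\<integral>x. indicator (cball 0 (1 + e) - cball 0 1) x * k (x /\<^sub>R norm x) \<partial>lborel) =
      ((1 + e) ^ DIM('a) - 1) * measure lborel (cball (0::'a) 1) * (\<integral>u. k u \<partial>uniform_sphere)"
    unfolding eq using e
    by (subst Bochner_Integration.integral_diff[OF int int])
      (simp add: integral_cball_radial_projection left_diff_distrib)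
qed

section \<open>The sphere average as a subgradient of the ball average\<close>

text \<open>
  A Lipschitz replacement for the indicator of the unit ball, falling linearly from 1 to 0 across the
  shell of radii between 1 and \<open>1 + e\<close>.  Unlike the indicator it can be differentiated almost
  everywhere, and its gradient \<open>- x / (e * norm x)\<close> lives on the shell.
\<close>
definition tent :: "real \<Rightarrow> 'a::euclidean_space \<Rightarrow> real" where
  "tent e x = max 0 (min 1 ((1 + e - norm x) / e))"

lemma continuous_on_tent: "continuous_on A (tent e)"
  unfolding tent_def divide_inverse by (intro continuous_intros)

lemma tent_bounds: "0 \<le> tent e x" "tent e x \<le> 1"
  by (auto simp: tent_def)

lemma tent_eq_1: "e > 0 \<Longrightarrow> norm x \<le> 1 \<Longrightarrow> tent e x = 1"
  by (auto simp: tent_def field_simps)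

lemma tent_eq_0: "e > 0 \<Longrightarrow> norm x \<ge> 1 + e \<Longrightarrow> tent e x = 0"
  by (auto simp: tent_def field_simps)

lemma tent_eq_linear:
  "e > 0 \<Longrightarrow> 1 \<le> norm x \<Longrightarrow> norm x \<le> 1 + e \<Longrightarrow> tent e x = (1 + e - norm x) / e"
  by (auto simp: tent_def field_simps)

lemma tent_lipschitz:
  assumes "e > 0"
  shows "\<bar>tent e x - tent e y\<bar> \<le> norm (x - y) / e"
proof -
  have "\<bar>tent e x - tent e y\<bar> \<le> \<bar>(1 + e - norm x) / e - (1 + e - norm y) / e\<bar>"
    unfolding tent_def by linarith
  also have "\<dots> = \<bar>norm x - norm y\<bar> / e"
    using assms by (simp add: diff_divide_distrib[symmetric] abs_divide)
  also have "\<dots> \<le> norm (x - y) / e"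
    using assms by (intro divide_right_mono norm_triangle_ineq3) auto
  finally show ?thesis .
qed

lemma norm_directional_difference_quotient:
  fixes x w :: "'a::real_inner"
  assumes x: "x \<noteq> 0" and s: "s \<longlonglongrightarrow> 0" and s0: "\<And>n. s n > (0::real)"
  shows "(\<lambda>n. (norm x - norm (x - s n *\<^sub>R w)) / s n) \<longlonglongrightarrow> (x /\<^sub>R norm x) \<bullet> w"
proof -
  have eq: "(norm x - norm (x - s n *\<^sub>R w)) / s n =
      (2 * (x \<bullet> w) - s n * (w \<bullet> w)) / (norm x + norm (x - s n *\<^sub>R w))" for n
  proof -
    have p: "norm x + norm (x - s n *\<^sub>R w) > 0" using x by (simp add: add_pos_nonneg)
    have "(norm x - norm (x - s n *\<^sub>R w)) * (norm x + norm (x - s n *\<^sub>R w)) =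
        (norm x)\<^sup>2 - (norm (x - s n *\<^sub>R w))\<^sup>2"
      by (simp add: power2_eq_square algebra_simps)
    also have "\<dots> = s n * (2 * (x \<bullet> w) - s n * (w \<bullet> w))"
      by (simp add: power2_norm_eq_inner inner_diff inner_commute algebra_simps)
    finally show ?thesis using p s0[of n] by (simp add: field_simps)
  qed
  have "(\<lambda>n. (2 * (x \<bullet> w) - s n * (w \<bullet> w)) / (norm x + norm (x - s n *\<^sub>R w)))
      \<longlonglongrightarrow> (2 * (x \<bullet> w) - 0 * (w \<bullet> w)) / (norm x + norm (x - 0 *\<^sub>R w))"
    using x by (intro tendsto_intros s) auto
  then show ?thesis unfolding eq by (simp add: field_simps)
qed

text \<open>
  The two excluded radii are the kinks of the tent; they form a null set.
\<close>
lemma tent_directional_difference_quotient: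
  fixes x w :: "'a::euclidean_space"
  assumes e: "e > 0" and x: "norm x \<noteq> 1" "norm x \<noteq> 1 + e"
    and s: "s \<longlonglongrightarrow> 0" and s0: "\<And>n. s n > (0::real)"
  shows "(\<lambda>n. (tent e (x - s n *\<^sub>R w) - tent e x) / s n) \<longlonglongrightarrow>
    indicator (cball 0 (1 + e) - cball 0 1) x * ((x /\<^sub>R norm x) \<bullet> w) / e"
proof -
  have lim: "(\<lambda>n. norm (x - s n *\<^sub>R w)) \<longlonglongrightarrow> norm x"
  proof -
    have "(\<lambda>n. norm (x - s n *\<^sub>R w)) \<longlonglongrightarrow> norm (x - 0 *\<^sub>R w)"
      by (intro tendsto_intros s)
    then show ?thesis by simp
  qed
  consider "norm x < 1" | "1 < norm x" "norm x < 1 + e" | "norm x > 1 + e"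
    using x by linarith
  then show ?thesis
  proof cases
    case 1
    have "\<forall>\<^sub>F n in sequentially. (tent e (x - s n *\<^sub>R w) - tent e x) / s n = 0"
      using order_tendstoD(2)[OF lim 1] by eventually_elim (use 1 e in \<open>simp add: tent_eq_1\<close>)
    then show ?thesis using 1 by (simp add: tendsto_eventually)
  next
    case 2
    have "(\<lambda>n. (norm x - norm (x - s n *\<^sub>R w)) / s n / e) \<longlonglongrightarrow> ((x /\<^sub>R norm x) \<bullet> w) / e"
      using 2 e by (intro tendsto_intros norm_directional_difference_quotient s s0) auto
    moreover have "\<forall>\<^sub>F n in sequentially. (norm x - norm (x - s n *\<^sub>R w)) / s n / e =
        (tent e (x - s n *\<^sub>R w) - tent e x) / s n"
      using order_tendstoD(1)[OF lim 2(1)] order_tendstoD(2)[OF lim 2(2)]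
      by eventually_elim
        (use 2 e in \<open>simp add: tent_eq_linear diff_divide_distrib[symmetric] mult.commute\<close>)
    ultimately have "(\<lambda>n. (tent e (x - s n *\<^sub>R w) - tent e x) / s n) \<longlonglongrightarrow> ((x /\<^sub>R norm x) \<bullet> w) / e"
      by (rule Lim_transform_eventually)
    then show ?thesis using 2 by simp
  next
    case 3
    have "\<forall>\<^sub>F n in sequentially. (tent e (x - s n *\<^sub>R w) - tent e x) / s n = 0"
      using order_tendstoD(1)[OF lim 3] by eventually_elim (use 3 e in \<open>simp add: tent_eq_0\<close>)
    then show ?thesis using 3 by (simp add: tendsto_eventually)
  qed
qed

lemma AE_lborel_norm_neq: "AE x in (lborel :: 'a::euclidean_space measure). norm x \<noteq> r"
proof -
  have "negligible (sphere (0::'a) r)" by (rule negligible_sphere)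
  then have "sphere (0::'a) r \<in> null_sets lebesgue" by (simp add: negligible_iff_null_sets)
  then have "sphere (0::'a) r \<in> null_sets lborel"
    by (simp add: null_sets_def)
  then show ?thesis
    by (rule AE_I') (auto simp: dist_norm)
qed

lemma integrable_tent_mult:
  fixes g :: "'a::euclidean_space \<Rightarrow> real"
  assumes e: "e > 0" and g: "continuous_on UNIV g"
  shows "integrable lborel (\<lambda>x. tent e x * g x)"
proof -
  have "integrable lborel (\<lambda>x. indicator (cball 0 (1 + e)) x * (tent e x * g x))"
    by (intro integrable_mult_indicator_cball continuous_intros g continuous_on_tent)
  moreover have "(\<lambda>x. indicator (cball 0 (1 + e)) x * (tent e x * g x)) = (\<lambda>x. tent e x * g x)"
    using e by (auto simp: indicator_def fun_eq_iff tent_eq_0)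
  ultimately show ?thesis by simp
qed

text \<open>
  Integration by parts in the direction \<open>w\<close>.  Convexity bounds the increment \<open>h (x + w) - h x\<close> below
  by every difference quotient \<open>(h (x + s w) - h x) / s\<close> with \<open>0 < s \<le> 1\<close>.  After integration against
  the tent, a translation moves the difference quotient from \<open>h\<close>, which may fail to be differentiable,
  to the tent, whose difference quotients converge almost everywhere and stay bounded by
  \<open>norm w / e\<close> on a fixed ball.
\<close>
lemma tent_shell_inequality:
  fixes h :: "'a::euclidean_space \<Rightarrow> real"
  assumes h: "convex_on UNIV h" "continuous_on UNIV h" and e: "e > 0"
  shows "(\<integral>x. indicator (cball 0 (1 + e) - cball 0 1) x * (h x * ((x /\<^sub>R norm x) \<bullet> w)) / e \<partial>lborel)
    \<le> (\<integral>x. tent e x * (h (x + w) - h x) \<partial>lborel)"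
proof -
  define s where "s n = 1 / real (Suc n)" for n
  have s: "s \<longlonglongrightarrow> 0" and s0: "\<And>n. s n > 0" and s1: "\<And>n. s n \<le> 1"
    using LIMSEQ_inverse_real_of_nat by (auto simp: s_def[abs_def] inverse_eq_divide)
  have hcont: "continuous_on UNIV (\<lambda>x. h (x + c))" for c
    by (intro continuous_on_compose2[OF h(2)] continuous_intros) auto
  have [measurable]: "h \<in> borel_measurable borel" "tent e \<in> borel_measurable borel"
    using h(2) continuous_on_tent by (auto intro: borel_measurable_continuous_onI)
  define R where "R = 1 + e + norm w"
  let ?D = "\<lambda>n x. (tent e (x - s n *\<^sub>R w) - tent e x) / s n"
  have bound: "(\<integral>x. h x * ?D n x \<partial>lborel) \<le> (\<integral>x. tent e x * (h (x + w) - h x) \<partial>lborel)" for n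
  proof -
    have i1: "integrable lborel (\<lambda>x. tent e x * h (x + s n *\<^sub>R w))"
      by (intro integrable_tent_mult e hcont)
    have i2: "integrable lborel (\<lambda>x. tent e x * h x)"
      by (intro integrable_tent_mult e h)
    have i3: "integrable lborel (\<lambda>x. tent e (x - s n *\<^sub>R w) * h x)"
      using lborel_integrable_translate[OF i1, of "- (s n *\<^sub>R w)"] by simp
    have "(\<integral>x. h x * ?D n x \<partial>lborel) =
        (\<integral>x. (tent e (x - s n *\<^sub>R w) * h x - tent e x * h x) / s n \<partial>lborel)"
      by (intro Bochner_Integration.integral_cong) (auto simp: algebra_simps)
    also have "\<dots> = ((\<integral>x. tent e (x - s n *\<^sub>R w) * h x \<partial>lborel) - (\<integral>x. tent e x * h x \<partial>lborel)) / s n"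
      using i2 i3 by simp
    also have "(\<integral>x. tent e (x - s n *\<^sub>R w) * h x \<partial>lborel) =
        (\<integral>x. tent e x * h (x + s n *\<^sub>R w) \<partial>lborel)"
      using lborel_integral_translate[of "\<lambda>x. tent e (x - s n *\<^sub>R w) * h x" "s n *\<^sub>R w"] by simp
    also have "((\<integral>x. tent e x * h (x + s n *\<^sub>R w) \<partial>lborel) - (\<integral>x. tent e x * h x \<partial>lborel)) / s n =
        (\<integral>x. (tent e x * h (x + s n *\<^sub>R w) - tent e x * h x) / s n \<partial>lborel)"
      using i1 i2 by simp
    also have "\<dots> \<le> (\<integral>x. tent e x * (h (x + w) - h x) \<partial>lborel)"
    proof (rule integral_mono)
      show "integrable lborel (\<lambda>x. (tent e x * h (x + s n *\<^sub>R w) - tent e x * h x) / s n)"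
        using i1 i2 by simp
      show "integrable lborel (\<lambda>x. tent e x * (h (x + w) - h x))"
        by (intro integrable_tent_mult e continuous_intros hcont h)
      fix x :: 'a
      have "h ((1 - s n) *\<^sub>R x + s n *\<^sub>R (x + w)) \<le> (1 - s n) * h x + s n * h (x + w)"
        using s0[of n] s1[of n] by (intro convex_onD[OF h(1)]) auto
      also have "(1 - s n) *\<^sub>R x + s n *\<^sub>R (x + w) = x + s n *\<^sub>R w"
        by (simp add: algebra_simps)
      finally have "h (x + s n *\<^sub>R w) - h x \<le> s n * (h (x + w) - h x)"
        by (simp add: algebra_simps)
      then have "(h (x + s n *\<^sub>R w) - h x) / s n \<le> h (x + w) - h x"
        using s0[of n] by (simp add: field_simps)
      then have "tent e x * ((h (x + s n *\<^sub>R w) - h x) / s n) \<le> tent e x * (h (x + w) - h x)"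
        by (intro mult_left_mono tent_bounds)
      then show "(tent e x * h (x + s n *\<^sub>R w) - tent e x * h x) / s n \<le> tent e x * (h (x + w) - h x)"
        by (simp add: algebra_simps)
    qed
    finally show ?thesis .
  qed
  have "(\<lambda>n. \<integral>x. h x * ?D n x \<partial>lborel) \<longlonglongrightarrow>
      (\<integral>x. indicator (cball 0 (1 + e) - cball 0 1) x * (h x * ((x /\<^sub>R norm x) \<bullet> w)) / e \<partial>lborel)"
  proof (rule integral_dominated_convergence)
    show "integrable lborel (\<lambda>x. indicator (cball 0 R) x * (\<bar>h x\<bar> * (norm w / e)))"
      by (intro integrable_mult_indicator_cball continuous_intros h)
    have "AE x in (lborel :: 'a measure). norm x \<noteq> 1 \<and> norm x \<noteq> 1 + e"
      using AE_lborel_norm_neq[of 1] AE_lborel_norm_neq[of "1 + e"] by eventually_elim auto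
    then show "AE x in lborel. (\<lambda>n. h x * ?D n x) \<longlonglongrightarrow>
        indicator (cball 0 (1 + e) - cball 0 1) x * (h x * ((x /\<^sub>R norm x) \<bullet> w)) / e"
    proof eventually_elim
      case (elim x)
      have "(\<lambda>n. h x * ?D n x) \<longlonglongrightarrow>
          h x * (indicator (cball 0 (1 + e) - cball 0 1) x * ((x /\<^sub>R norm x) \<bullet> w) / e)"
        using elim by (intro tendsto_mult tendsto_const tent_directional_difference_quotient e s s0) auto
      then show ?case by (simp add: mult_ac)
    qed
    show "AE x in lborel. norm (h x * ?D n x) \<le> indicator (cball 0 R) x * (\<bar>h x\<bar> * (norm w / e))" for n
    proof (rule AE_I2)
      fix x :: 'a
      show "norm (h x * ?D n x) \<le> indicator (cball 0 R) x * (\<bar>h x\<bar> * (norm w / e))"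
      proof (cases "norm x \<le> R")
        case True
        have "\<bar>tent e (x - s n *\<^sub>R w) - tent e x\<bar> \<le> norm (x - s n *\<^sub>R w - x) / e"
          by (rule tent_lipschitz[OF e])
        then have "\<bar>?D n x\<bar> \<le> norm w / e"
          using s0[of n] e by (simp add: abs_divide field_simps)
        then have "\<bar>h x\<bar> * \<bar>?D n x\<bar> \<le> \<bar>h x\<bar> * (norm w / e)"
          by (rule mult_left_mono) simp
        then show ?thesis using True by (simp add: abs_mult)
      next
        case False
        have "norm (s n *\<^sub>R w) \<le> norm w"
          using s0[of n] s1[of n] by (simp add: mult_left_le_one_le)
        then have "norm (x - s n *\<^sub>R w) \<ge> 1 + e" "norm x \<ge> 1 + e"
          using False norm_triangle_ineq2[of x "s n *\<^sub>R w"] norm_ge_zero[of w]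
          unfolding R_def by linarith+
        then show ?thesis using False e by (simp add: tent_eq_0)
      qed
    qed
  qed measurable
  then show ?thesis
    by (rule LIMSEQ_le_const2) (use bound in auto)
qed

text \<open>
  For smooth \<open>h\<close> the left-hand side is the derivative in direction \<open>w\<close> at 0 of the average of \<open>h\<close> over
  the unit ball around a point, by the divergence theorem, and the inequality is the convexity of
  that average.  For general \<open>h\<close> it is the limit \<open>e \<longlongrightarrow> 0\<close> of the inequality for the tent: on a
  shell of width \<open>e\<close> the function \<open>h\<close> differs by at most \<open>L * e\<close> from its value at the
  radial projection, and the part of the tent outside the ball has mass of order \<open>e\<close>.
\<close>
lemma sphere_average_subgradient:
  fixes h :: "'a::euclidean_space \<Rightarrow> real"
  assumes h: "convex_on UNIV h" and lip: "L-lipschitz_on UNIV h"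
  shows "DIM('a) * (\<integral>u. h u * (u \<bullet> w) \<partial>uniform_sphere) \<le>
    (\<integral>v. h (v + w) - h v \<partial>uniform_measure lborel (cball 0 1))"
proof -
  define V where "V = measure lborel (cball (0::'a) 1)"
  define E where "E = (\<integral>u. h u * (u \<bullet> w) \<partial>uniform_sphere)"
  define J where "J = (\<integral>x. indicator (cball 0 1) x * (h (x + w) - h x) \<partial>lborel)"
  have V: "V > 0" unfolding V_def by (rule measure_unit_cball_pos)
  have L: "L \<ge> 0" and Lh: "\<bar>h x - h y\<bar> \<le> L * norm (x - y)" for x y
    using lip by (auto simp: lipschitz_on_def dist_norm dist_real_def)
  have hc: "continuous_on UNIV h" by (rule lipschitz_on_continuous_on[OF lip])
  have hcont: "continuous_on UNIV (\<lambda>x. h (x + c))" for c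
    by (intro continuous_on_compose2[OF hc] continuous_intros) auto
  have [measurable]: "h \<in> borel_measurable borel"
    using hc by (rule borel_measurable_continuous_onI)
  \<comment> \<open>Each side contributes an error of \<open>L * norm w\<close> times the volume of the shell: the left one by the
    radial projection of \<open>h\<close>, the right one by the tent outside the ball.\<close>
  have main: "((1 + e) ^ DIM('a) - 1) / e * (V * E) \<le> J + 2 * L * norm w * (((1 + e) ^ DIM('a) - 1) * V)"
    if e: "e > 0" for e
  proof -
    let ?S = "cball (0::'a) (1 + e) - cball 0 1"
    let ?m = "((1 + e) ^ DIM('a) - 1) * V"
    interpret prob_space "uniform_sphere :: 'a measure" by (rule prob_space_uniform_sphere)
    have iS: "integrable lborel (indicator ?S :: 'a \<Rightarrow> real)"
      and mS: "(\<integral>x. indicator ?S x \<partial>lborel) = ?m"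
      using integral_shell_radial_projection[where k = "\<lambda>_::'a. 1", OF continuous_on_const e]
      by (simp_all add: V_def prob_space del: integral_indicator integrable_indicator_iff)
    have mS': "measure lborel ?S = ?m" using mS by simp
    have ck: "continuous_on UNIV (\<lambda>u. h u * (u \<bullet> w))"
      by (intro continuous_intros hc)
    note kS = integral_shell_radial_projection[OF ck e]
    have "?m / e * E - L * norm w * ?m =
        (\<integral>x. indicator ?S x * (h (x /\<^sub>R norm x) * ((x /\<^sub>R norm x) \<bullet> w)) / e
            - L * norm w * indicator ?S x \<partial>lborel)"
      using kS iS by (simp add: mS' E_def flip: V_def)
    also have "\<dots> \<le> (\<integral>x. indicator ?S x * (h x * ((x /\<^sub>R norm x) \<bullet> w)) / e \<partial>lborel)"
    proof (rule integral_mono)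
      show "integrable lborel (\<lambda>x. indicator ?S x * (h (x /\<^sub>R norm x) * ((x /\<^sub>R norm x) \<bullet> w)) / e
            - L * norm w * indicator ?S x)"
        using kS iS by simp
      have "integrable lborel (\<lambda>x. indicator (cball 0 (1 + e)) x * (\<bar>h x\<bar> * (norm w / e)))"
        by (intro integrable_mult_indicator_cball continuous_intros hc)
      then show "integrable lborel (\<lambda>x. indicator ?S x * (h x * ((x /\<^sub>R norm x) \<bullet> w)) / e)"
      proof (rule Bochner_Integration.integrable_bound)
        show "AE x in lborel. norm (indicator ?S x * (h x * ((x /\<^sub>R norm x) \<bullet> w)) / e)
            \<le> norm (indicator (cball 0 (1 + e)) x * (\<bar>h x\<bar> * (norm w / e)))"
        proof (rule AE_I2)
          fix x :: 'a
          have "\<bar>(x /\<^sub>R norm x) \<bullet> w\<bar> \<le> norm w"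
            using Cauchy_Schwarz_ineq2[of "x /\<^sub>R norm x" w] by (cases "x = 0") auto
          then have "\<bar>h x\<bar> * \<bar>(x /\<^sub>R norm x) \<bullet> w\<bar> / e \<le> \<bar>h x\<bar> * norm w / e"
            using e by (intro divide_right_mono mult_left_mono) auto
          then show "norm (indicator ?S x * (h x * ((x /\<^sub>R norm x) \<bullet> w)) / e)
              \<le> norm (indicator (cball 0 (1 + e)) x * (\<bar>h x\<bar> * (norm w / e)))"
            using e by (auto simp: indicator_def abs_mult simp del: inner_scaleR_left)
        qed
      qed measurable
      fix x :: 'a
      show "indicator ?S x * (h (x /\<^sub>R norm x) * ((x /\<^sub>R norm x) \<bullet> w)) / e - L * norm w * indicator ?S x
          \<le> indicator ?S x * (h x * ((x /\<^sub>R norm x) \<bullet> w)) / e"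
      proof (cases "x \<in> ?S")
        case True
        define y where "y = x /\<^sub>R norm x"
        have nx: "norm x > 1" "norm x \<le> 1 + e" using True by auto
        have "x \<noteq> 0" using nx by auto
        then have ny: "norm y = 1" unfolding y_def by simp
        have "norm x *\<^sub>R y = x" using \<open>x \<noteq> 0\<close> by (simp add: y_def)
        then have "x - y = (norm x - 1) *\<^sub>R y" by (simp add: scaleR_left_diff_distrib)
        then have "norm (x - y) = norm x - 1" using nx ny by simp
        then have "\<bar>h y - h x\<bar> \<le> L * e"
          using Lh[of y x] nx L by (smt (verit) mult_left_mono norm_minus_commute)
        moreover have "\<bar>y \<bullet> w\<bar> \<le> norm w"
          using Cauchy_Schwarz_ineq2[of y w] ny by simp
        ultimately have "\<bar>h y - h x\<bar> * \<bar>y \<bullet> w\<bar> \<le> (L * e) * norm w"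
          using L e by (intro mult_mono) auto
        then have "h y * (y \<bullet> w) - h x * (y \<bullet> w) \<le> L * norm w * e"
          by (metis abs_le_iff abs_mult left_diff_distrib mult.assoc mult.commute)
        then have "(h y * (y \<bullet> w) - h x * (y \<bullet> w)) / e \<le> L * norm w"
          using e by (simp add: pos_divide_le_eq)
        then have "h y * (y \<bullet> w) / e - L * norm w \<le> h x * (y \<bullet> w) / e"
          by (simp add: diff_divide_distrib)
        then show ?thesis using True by (simp add: y_def)
      qed simp
    qed
    also have "\<dots> \<le> (\<integral>x. tent e x * (h (x + w) - h x) \<partial>lborel)"
      by (rule tent_shell_inequality[OF h hc e])
    also have "\<dots> \<le> (\<integral>x. indicator (cball 0 1) x * (h (x + w) - h x) + L * norm w * indicator ?S x \<partial>lborel)"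
    proof (rule integral_mono)
      show "integrable lborel (\<lambda>x. tent e x * (h (x + w) - h x))"
        by (intro integrable_tent_mult e continuous_intros hcont hc)
      have "integrable lborel (\<lambda>x. indicator (cball 0 1) x * (h (x + w) - h x))"
        by (intro integrable_mult_indicator_cball continuous_intros hcont hc)
      then show "integrable lborel (\<lambda>x. indicator (cball 0 1) x * (h (x + w) - h x) + L * norm w * indicator ?S x)"
        using iS by simp
      fix x :: 'a
      consider "norm x \<le> 1" | "1 < norm x" "norm x \<le> 1 + e" | "norm x > 1 + e" by linarith
      then show "tent e x * (h (x + w) - h x)
          \<le> indicator (cball 0 1) x * (h (x + w) - h x) + L * norm w * indicator ?S x"
      proof cases
        case 2
        have "\<bar>tent e x\<bar> * \<bar>h (x + w) - h x\<bar> \<le> 1 * (L * norm w)"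
          using tent_bounds[of e x] Lh[of "x + w" x] by (intro mult_mono) auto
        then have "tent e x * (h (x + w) - h x) \<le> L * norm w"
          by (metis abs_le_iff abs_mult mult_1)
        then show ?thesis using 2 by simp
      qed (use e in \<open>simp_all add: tent_eq_1 tent_eq_0\<close>)
    qed
    also have "\<dots> = J + L * norm w * ?m"
    proof -
      have "integrable lborel (\<lambda>x. indicator (cball 0 1) x * (h (x + w) - h x))"
        by (intro integrable_mult_indicator_cball continuous_intros hcont hc)
      then show ?thesis using iS by (simp add: J_def mS')
    qed
    finally show ?thesis by (simp add: algebra_simps)
  qed
  \<comment> \<open>\<open>((1 + e) ^ d - 1) / e\<close> is the difference quotient of the \<open>d\<close>-th power at 1.\<close>
  have "DIM('a) * (V * E) \<le> J"
  proof (rule tendsto_le)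
    show "((\<lambda>e. ((1 + e) ^ DIM('a) - 1) / e * (V * E)) \<longlongrightarrow> DIM('a) * (V * E)) (at_right 0)"
    proof (intro tendsto_mult tendsto_const)
      have "((\<lambda>x::real. x ^ DIM('a)) has_real_derivative real DIM('a)) (at 1)"
        by (auto intro!: derivative_eq_intros)
      then have "((\<lambda>e::real. ((1 + e) ^ DIM('a) - 1) / e) \<longlongrightarrow> real DIM('a)) (at 0)"
        by (simp add: DERIV_def)
      then show "((\<lambda>e::real. ((1 + e) ^ DIM('a) - 1) / e) \<longlongrightarrow> real DIM('a)) (at_right 0)"
        by (rule filterlim_mono) (auto simp: at_le)
    qed
    have "((\<lambda>e. J + 2 * L * norm w * (((1 + e) ^ DIM('a) - 1) * V)) \<longlongrightarrow>
        J + 2 * L * norm w * (((1 + 0) ^ DIM('a) - 1) * V)) (at_right 0)"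
      by (intro tendsto_intros)
    then show "((\<lambda>e. J + 2 * L * norm w * (((1 + e) ^ DIM('a) - 1) * V)) \<longlongrightarrow> J) (at_right 0)"
      by simp
    show "\<forall>\<^sub>F e in at_right 0. ((1 + e) ^ DIM('a) - 1) / e * (V * E)
        \<le> J + 2 * L * norm w * (((1 + e) ^ DIM('a) - 1) * V)"
      using eventually_at_right_less[of "0::real"] by eventually_elim (rule main)
  qed simp
  then have "DIM('a) * E \<le> J / V" using V by (simp add: field_simps)
  moreover have "(\<integral>v. h (v + w) - h v \<partial>uniform_measure lborel (cball 0 1)) = J / V"
    unfolding J_def V_def by (rule integral_uniform_unit_cball) measurable
  ultimately show ?thesis by (simp add: E_def)
qed

section \<open>The one-point gradient estimate of a convex function\<close>

lemma uniform_unit_cball_symmetric: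
  fixes g :: "'a::euclidean_space \<Rightarrow> real"
  assumes [measurable]: "g \<in> borel_measurable borel"
  shows "(\<integral>v. g (- v) \<partial>uniform_measure lborel (cball 0 1)) =
    (\<integral>v. g v \<partial>uniform_measure lborel (cball 0 1))"
proof -
  have "(\<integral>x. indicator (cball 0 1) x * g x \<partial>lborel) =
      \<bar>- 1\<bar> ^ DIM('a) * (\<integral>x. indicator (cball 0 1) (- 1 *\<^sub>R x) * g (- 1 *\<^sub>R x) \<partial>(lborel :: 'a measure))"
    by (rule lborel_integral_scale) auto
  also have "\<dots> = (\<integral>x. indicator (cball 0 1) x * g (- x) \<partial>lborel)"
    by (simp add: indicator_def)
  finally show ?thesis by (simp add: integral_uniform_unit_cball)
qed

lemma integrable_uniform_unit_cball:
  fixes g :: "'a::euclidean_space \<Rightarrow> real"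
  assumes g: "continuous_on UNIV g"
  shows "integrable (uniform_measure lborel (cball 0 1)) g"
proof -
  interpret prob_space "uniform_measure lborel (cball (0::'a) 1)"
    using emeasure_unit_cball_pos emeasure_unit_cball_finite by (intro prob_space_uniform_measure) auto
  have [measurable]: "g \<in> borel_measurable borel"
    using g by (rule borel_measurable_continuous_onI)
  obtain C where "\<And>u. norm u \<le> 1 \<Longrightarrow> \<bar>g u\<bar> \<le> C"
    using continuous_bounded_on_cball[OF g, of 1] by blast
  then show ?thesis
    by (intro integrable_const_bound[where B=C] AE_uniform_measureI) auto
qed

lemma integrable_uniform_sphere:
  fixes g :: "'a::euclidean_space \<Rightarrow> real"
  assumes g: "continuous_on UNIV g"
  shows "integrable uniform_sphere g"
proof -
  interpret prob_space "uniform_sphere :: 'a measure" by (rule prob_space_uniform_sphere)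
  have "g \<in> borel_measurable borel"
    using g by (rule borel_measurable_continuous_onI)
  then have [measurable]: "g \<in> borel_measurable uniform_sphere"
    by (simp add: uniform_sphere_def)
  obtain C where C: "\<And>u. norm u \<le> 1 \<Longrightarrow> \<bar>g u\<bar> \<le> C"
    using continuous_bounded_on_cball[OF g, of 1] by blast
  have "AE u in uniform_sphere. norm (g u) \<le> C"
    using AE_uniform_sphere[where 'a='a] by eventually_elim (use C in auto)
  then show ?thesis
    by (rule integrable_const_bound) measurable
qed

text \<open>
  The lower bound is the midpoint inequality for the antipodal pair \<open>x + \<alpha> v\<close>, \<open>x - \<alpha> v\<close>, averaged
  over \<open>v\<close>.
\<close>
lemma ball_average_bounds:
  fixes f :: "'a::euclidean_space \<Rightarrow> real"
  assumes f: "convex_on UNIV f" and lip: "L-lipschitz_on UNIV f" and "\<alpha> > 0"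
  shows "f x \<le> (\<integral>v. f (x + \<alpha> *\<^sub>R v) \<partial>uniform_measure lborel (cball 0 1))"
    and "(\<integral>v. f (x + \<alpha> *\<^sub>R v) \<partial>uniform_measure lborel (cball 0 1)) \<le> f x + \<alpha> * L"
proof -
  let ?U = "uniform_measure lborel (cball (0::'a) 1)"
  interpret prob_space ?U
    using emeasure_unit_cball_pos emeasure_unit_cball_finite by (intro prob_space_uniform_measure) auto
  have fc: "continuous_on UNIV f" by (rule lipschitz_on_continuous_on[OF lip])
  have c1: "continuous_on UNIV (\<lambda>v. f (x + a *\<^sub>R v))" for a
    by (intro continuous_on_compose2[OF fc] continuous_intros) auto
  have i1: "integrable ?U (\<lambda>v. f (x + a *\<^sub>R v))" for a
    by (intro integrable_uniform_unit_cball c1)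
  have "(\<integral>v. f (x + (- \<alpha>) *\<^sub>R v) \<partial>?U) = (\<integral>v. f (x + \<alpha> *\<^sub>R v) \<partial>?U)"
    using uniform_unit_cball_symmetric[of "\<lambda>v. f (x + \<alpha> *\<^sub>R v)"] c1
    by (simp add: borel_measurable_continuous_onI)
  then have "2 * (\<integral>v. f (x + \<alpha> *\<^sub>R v) \<partial>?U) =
      (\<integral>v. f (x + \<alpha> *\<^sub>R v) + f (x + (- \<alpha>) *\<^sub>R v) \<partial>?U)"
    by (subst Bochner_Integration.integral_add[OF i1 i1]) simp
  also have "\<dots> \<ge> (\<integral>v. 2 * f x \<partial>?U)"
  proof (intro integral_mono Bochner_Integration.integrable_add i1)
    fix v
    have "f ((1 - 1/2) *\<^sub>R (x + \<alpha> *\<^sub>R v) + (1/2) *\<^sub>R (x + (- \<alpha>) *\<^sub>R v)) \<le>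
        (1 - 1/2) * f (x + \<alpha> *\<^sub>R v) + (1/2) * f (x + (- \<alpha>) *\<^sub>R v)"
      by (rule convex_onD[OF f]) auto
    moreover have "(1 - 1/2) *\<^sub>R (x + \<alpha> *\<^sub>R v) + (1/2) *\<^sub>R (x + (- \<alpha>) *\<^sub>R v) = x"
      by (simp add: algebra_simps flip: scaleR_left_distrib)
    ultimately show "2 * f x \<le> f (x + \<alpha> *\<^sub>R v) + f (x + (- \<alpha>) *\<^sub>R v)"
      by simp
  qed simp
  finally show "f x \<le> (\<integral>v. f (x + \<alpha> *\<^sub>R v) \<partial>?U)"
    using prob_space by simp
  have "(\<integral>v. f (x + \<alpha> *\<^sub>R v) \<partial>?U) \<le> (\<integral>v. f x + \<alpha> * L \<partial>?U)"
  proof (intro integral_mono_AE i1 AE_uniform_measureI AE_I2 impI)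
    fix v :: 'a assume v: "v \<in> cball 0 1"
    have "\<bar>f (x + \<alpha> *\<^sub>R v) - f x\<bar> \<le> L * (\<alpha> * norm v)"
      using lipschitz_onD[OF lip, of "x + \<alpha> *\<^sub>R v" x] \<open>\<alpha> > 0\<close> by (simp add: dist_norm)
    also have "\<dots> \<le> L * (\<alpha> * 1)"
      using v \<open>\<alpha> > 0\<close> lipschitz_on_nonneg[OF lip] by (intro mult_left_mono) auto
    finally show "f (x + \<alpha> *\<^sub>R v) \<le> f x + \<alpha> * L" by (simp add: mult.commute)
  qed simp_all
  then show "(\<integral>v. f (x + \<alpha> *\<^sub>R v) \<partial>?U) \<le> f x + \<alpha> * L"
    using prob_space by simp
qed

lemma convex_on_affine_shift:
  fixes f :: "'a::real_vector \<Rightarrow> real"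
  assumes "convex_on UNIV f"
  shows "convex_on UNIV (\<lambda>v. f (x + a *\<^sub>R v) - c)"
proof (rule convex_onI)
  fix t :: real and y z :: 'a assume t: "0 < t" "t < 1"
  have "x + a *\<^sub>R ((1 - t) *\<^sub>R y + t *\<^sub>R z) = (1 - t) *\<^sub>R (x + a *\<^sub>R y) + t *\<^sub>R (x + a *\<^sub>R z)"
    by (simp add: algebra_simps)
  then show "f (x + a *\<^sub>R ((1 - t) *\<^sub>R y + t *\<^sub>R z)) - c \<le>
      (1 - t) * (f (x + a *\<^sub>R y) - c) + t * (f (x + a *\<^sub>R z) - c)"
    using convex_onD[OF assms, of t "x + a *\<^sub>R y" "x + a *\<^sub>R z"] t by (simp add: algebra_simps)
qed simp

lemma lipschitz_on_affine_shift:
  fixes f :: "'a::real_normed_vector \<Rightarrow> real"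
  assumes "L-lipschitz_on UNIV f" "a > 0"
  shows "(a * L)-lipschitz_on UNIV (\<lambda>v. f (x + a *\<^sub>R v) - c)"
proof (rule lipschitz_onI)
  fix v w :: 'a
  have "dist (x + a *\<^sub>R v) (x + a *\<^sub>R w) = a * dist v w"
    using assms(2) by (simp add: dist_norm flip: scaleR_diff_right)
  then show "dist (f (x + a *\<^sub>R v) - c) (f (x + a *\<^sub>R w) - c) \<le> a * L * dist v w"
    using lipschitz_onD[OF assms(1), of "x + a *\<^sub>R v" "x + a *\<^sub>R w"]
    by (simp add: dist_real_def mult_ac)
qed (use assms lipschitz_on_nonneg[OF assms(1)] in simp)

text \<open>
  The mean of the gradient estimate is a subgradient at \<open>x\<close> of the ball average of \<open>f\<close>, and this
  average exceeds \<open>f\<close> by at most \<open>\<alpha> * L\<close> and never falls below it.  The constant \<open>c\<close> stands for the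
  function value of the previous round; it is subtracted inside the convex function to which the
  subgradient inequality is applied, whose increments do not see it.
\<close>
lemma one_point_estimate_lower_bound:
  fixes f :: "'a::euclidean_space \<Rightarrow> real"
  assumes f: "convex_on UNIV f" and lip: "L-lipschitz_on UNIV f" and \<alpha>: "\<alpha> > 0"
  shows "f x - f y - \<alpha> * L \<le>
    (\<integral>v. ((DIM('a) * ((f (x + \<alpha> *\<^sub>R v) - c) / \<alpha>)) *\<^sub>R v) \<bullet> (x - y) \<partial>uniform_sphere)"
proof -
  let ?U = "uniform_measure lborel (cball (0::'a) 1)"
  define w where "w = (y - x) /\<^sub>R \<alpha>"
  have fc: "continuous_on UNIV f" by (rule lipschitz_on_continuous_on[OF lip])
  have i1: "integrable ?U (\<lambda>v. f (z + \<alpha> *\<^sub>R v))" for z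
    by (intro integrable_uniform_unit_cball continuous_on_compose2[OF fc] continuous_intros) auto
  have shift: "x + \<alpha> *\<^sub>R (v + w) = y + \<alpha> *\<^sub>R v" for v
    using \<alpha> by (simp add: w_def algebra_simps)
  have "DIM('a) * (\<integral>u. (f (x + \<alpha> *\<^sub>R u) - c) * (u \<bullet> w) \<partial>uniform_sphere) \<le>
      (\<integral>v. (f (x + \<alpha> *\<^sub>R (v + w)) - c) - (f (x + \<alpha> *\<^sub>R v) - c) \<partial>?U)"
    by (rule sphere_average_subgradient[OF convex_on_affine_shift[OF f]
          lipschitz_on_affine_shift[OF lip \<alpha>]])
  also have "\<dots> = (\<integral>v. f (y + \<alpha> *\<^sub>R v) \<partial>?U) - (\<integral>v. f (x + \<alpha> *\<^sub>R v) \<partial>?U)"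
    unfolding shift using i1 by simp
  also have "\<dots> \<le> f y + \<alpha> * L - f x"
    using ball_average_bounds[OF f lip \<alpha>] by (intro diff_mono) auto
  finally have "f x - f y - \<alpha> * L \<le>
      (\<integral>u. - real DIM('a) * ((f (x + \<alpha> *\<^sub>R u) - c) * (u \<bullet> w)) \<partial>uniform_sphere)"
    by simp
  also have "(\<lambda>u. - real DIM('a) * ((f (x + \<alpha> *\<^sub>R u) - c) * (u \<bullet> w))) =
      (\<lambda>v. ((DIM('a) * ((f (x + \<alpha> *\<^sub>R v) - c) / \<alpha>)) *\<^sub>R v) \<bullet> (x - y))"
    using \<alpha> by (auto simp: w_def fun_eq_iff inner_diff_right field_simps)
  finally show ?thesis .
qed

lemma sphere_average_lipschitz:
  fixes f :: "'a::euclidean_space \<Rightarrow> real"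
  assumes lip: "L-lipschitz_on UNIV f"
  shows "L-lipschitz_on UNIV (\<lambda>x. \<integral>v. f (x + \<alpha> *\<^sub>R v) \<partial>uniform_sphere)"
proof (rule lipschitz_onI)
  interpret prob_space "uniform_sphere :: 'a measure" by (rule prob_space_uniform_sphere)
  have fc: "continuous_on UNIV f" by (rule lipschitz_on_continuous_on[OF lip])
  have i1: "integrable uniform_sphere (\<lambda>v. f (z + \<alpha> *\<^sub>R v))" for z
    by (intro integrable_uniform_sphere continuous_on_compose2[OF fc] continuous_intros) auto
  fix x y :: 'a
  have d: "\<bar>f (x + \<alpha> *\<^sub>R v) - f (y + \<alpha> *\<^sub>R v)\<bar> \<le> L * dist x y" for v
    using lipschitz_onD[OF lip, of "x + \<alpha> *\<^sub>R v" "y + \<alpha> *\<^sub>R v"] by (simp add: dist_real_def dist_norm)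
  have "\<bar>(\<integral>v. f (x + \<alpha> *\<^sub>R v) \<partial>uniform_sphere) - (\<integral>v. f (y + \<alpha> *\<^sub>R v) \<partial>uniform_sphere)\<bar> =
      \<bar>\<integral>v. f (x + \<alpha> *\<^sub>R v) - f (y + \<alpha> *\<^sub>R v) \<partial>uniform_sphere\<bar>"
    using i1 by simp
  also have "\<dots> \<le> (\<integral>v. \<bar>f (x + \<alpha> *\<^sub>R v) - f (y + \<alpha> *\<^sub>R v)\<bar> \<partial>uniform_sphere)"
    by (rule integral_abs_bound)
  also have "\<dots> \<le> (\<integral>v. L * dist x y \<partial>(uniform_sphere :: 'a measure))"
    using i1 d by (intro integral_mono) auto
  finally show "dist (\<integral>v. f (x + \<alpha> *\<^sub>R v) \<partial>uniform_sphere) (\<integral>v. f (y + \<alpha> *\<^sub>R v) \<partial>uniform_sphere)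
      \<le> L * dist x y"
    by (simp add: dist_real_def prob_space)
qed (rule lipschitz_on_nonneg[OF lip])

section \<open>Variance of a Lipschitz function on the sphere\<close>

text \<open>
  An orthonormal basis carries the moment hypothesis, which is stated in coordinates, over to the
  ambient space.  The second moment is then at most the root of the fourth because
  the square of the deviation has nonnegative variance.
\<close>
lemma sphere_variance_le:
  fixes h :: "'a::euclidean_space \<Rightarrow> real"
  assumes c: "sphere_fourth_moment_constant c" and M: "M > 0" and lip: "M-lipschitz_on UNIV h"
  shows "(\<integral>u. (h u - (\<integral>v. h v \<partial>uniform_sphere))\<^sup>2 \<partial>uniform_sphere) \<le> c * M\<^sup>2 / DIM('a)"
proof -
  let ?d = "DIM('a)"
  interpret prob_space "uniform_sphere :: 'a measure" by (rule prob_space_uniform_sphere)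
  have hc: "continuous_on UNIV h" by (rule lipschitz_on_continuous_on[OF lip])
  then have [measurable]: "h \<in> borel_measurable borel" by (rule borel_measurable_continuous_onI)
  define m where "m = (\<integral>v. h v \<partial>uniform_sphere)"
  obtain e where e: "bij_betw e {..<?d} (Basis :: 'a set)"
    using ex_bij_betw_nat_finite[OF finite_Basis] by (auto simp: lessThan_atLeast0)
  define \<phi> :: "(nat \<Rightarrow> real) \<Rightarrow> 'a" where "\<phi> x = (\<Sum>i<?d. x i *\<^sub>R e i)" for x
  have norm_\<phi>: "norm (\<phi> x) = L2_set x {..<?d}" for x
  proof -
    have "pairwise (\<lambda>i j. orthogonal (x i *\<^sub>R e i) (x j *\<^sub>R e j)) {..<?d}"
      using e by (auto simp: pairwise_def orthogonal_def bij_betw_def inj_on_def intro!: inner_not_same_Basis)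
    then have "(norm (\<phi> x))\<^sup>2 = (\<Sum>i<?d. (norm (x i *\<^sub>R e i))\<^sup>2)"
      unfolding \<phi>_def by (intro norm_sum_Pythagorean) auto
    also have "\<dots> = (\<Sum>i<?d. (x i)\<^sup>2)"
    proof (intro sum.cong refl)
      fix i assume "i \<in> {..<?d}"
      then have "e i \<in> Basis" using e by (auto simp: bij_betw_def)
      then show "(norm (x i *\<^sub>R e i))\<^sup>2 = (x i)\<^sup>2" by simp
    qed
    finally show ?thesis unfolding L2_set_def by (metis norm_ge_zero real_sqrt_unique)
  qed
  have sets: "sets (uniform_sphere_coords ?d) = sets (\<Pi>\<^sub>M i\<in>{..<?d}. borel)"
    unfolding uniform_sphere_coords_def lborel_coords_def by (simp cong: sets_PiM_cong)
  have [measurable]: "\<phi> \<in> borel_measurable (uniform_sphere_coords ?d)"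
    unfolding measurable_cong_sets[OF sets refl] \<phi>_def by measurable
  have distr_\<phi>: "distr (uniform_sphere_coords ?d) borel \<phi> = uniform_sphere"
    using uniform_sphere_eq_coords[OF e] by (simp add: \<phi>_def[abs_def])
  have transfer: "(\<integral>x. g (\<phi> x) \<partial>uniform_sphere_coords ?d) = (\<integral>u. g u \<partial>uniform_sphere)"
    if [measurable]: "g \<in> borel_measurable borel" for g :: "'a \<Rightarrow> real"
    using integral_distr[of \<phi> "uniform_sphere_coords ?d" borel g] by (simp add: distr_\<phi>)
  have "\<bar>h (\<phi> x) - h (\<phi> y)\<bar> \<le> M * L2_set (\<lambda>i. x i - y i) {..<?d}" for x y
  proof -
    have "\<phi> x - \<phi> y = \<phi> (\<lambda>i. x i - y i)"
      by (simp add: \<phi>_def scaleR_left_diff_distrib sum_subtractf)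
    then have "dist (\<phi> x) (\<phi> y) = L2_set (\<lambda>i. x i - y i) {..<?d}"
      by (simp add: dist_norm norm_\<phi>)
    then show ?thesis
      using lipschitz_onD[OF lip, of "\<phi> x" "\<phi> y"] by (simp add: dist_real_def)
  qed
  then have "sqrt (\<integral>u. (h (\<phi> u) - (\<integral>v. h (\<phi> v) \<partial>uniform_sphere_coords ?d)) ^ 4
      \<partial>uniform_sphere_coords ?d) \<le> c * M\<^sup>2 / real ?d"
    using c[unfolded sphere_fourth_moment_constant_def, THEN conjunct2, rule_format,
        of ?d M "\<lambda>x. h (\<phi> x)"] M by simp
  then have fourth: "sqrt (\<integral>u. (h u - m) ^ 4 \<partial>uniform_sphere) \<le> c * M\<^sup>2 / real ?d"
    using transfer[of "\<lambda>u. (h u - m) ^ 4"] by (simp add: transfer m_def)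
  have "0 \<le> variance (\<lambda>u. (h u - m)\<^sup>2)" by (rule variance_positive)
  also have "variance (\<lambda>u. (h u - m)\<^sup>2) =
      (\<integral>u. ((h u - m)\<^sup>2)\<^sup>2 \<partial>uniform_sphere) - (\<integral>u. (h u - m)\<^sup>2 \<partial>uniform_sphere)\<^sup>2"
    by (intro variance_eq integrable_uniform_sphere continuous_intros hc)
  finally have "(\<integral>u. (h u - m)\<^sup>2 \<partial>uniform_sphere)\<^sup>2 \<le> (\<integral>u. (h u - m) ^ 4 \<partial>uniform_sphere)"
    by simp
  then have "(\<integral>u. (h u - m)\<^sup>2 \<partial>uniform_sphere) \<le> sqrt (\<integral>u. (h u - m) ^ 4 \<partial>uniform_sphere)"
    by (rule real_le_rsqrt)
  with fourth show ?thesis by (simp add: m_def)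
qed

section \<open>Independence and integrability\<close>

text \<open>
  Fubini on the joint law of \<open>X\<close> and \<open>Y\<close>, which is the product of their laws.
\<close>
lemma (in prob_space) expectation_indep_iterated:
  fixes G :: "'b \<Rightarrow> 'b \<Rightarrow> real"
  assumes indep: "indep_var N X N' Y"
    and G: "(\<lambda>(a, b). G a b) \<in> borel_measurable (N \<Otimes>\<^sub>M N')"
    and int: "integrable M (\<lambda>\<omega>. G (X \<omega>) (Y \<omega>))"
  shows "integrable M (\<lambda>\<omega>. \<integral>y. G (X \<omega>) y \<partial>distr M N' Y)"
    and "expectation (\<lambda>\<omega>. G (X \<omega>) (Y \<omega>)) = expectation (\<lambda>\<omega>. \<integral>y. G (X \<omega>) y \<partial>distr M N' Y)"
proof -
  have [measurable]: "X \<in> measurable M N" "Y \<in> measurable M N'"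
    and joint: "distr M N X \<Otimes>\<^sub>M distr M N' Y = distr M (N \<Otimes>\<^sub>M N') (\<lambda>\<omega>. (X \<omega>, Y \<omega>))"
    using indep by (auto simp: indep_var_distribution_eq)
  interpret X: prob_space "distr M N X" by (rule prob_space_distr) measurable
  interpret Y: prob_space "distr M N' Y" by (rule prob_space_distr) measurable
  interpret pair_sigma_finite "distr M N X" "distr M N' Y" ..
  let ?G = "\<lambda>z. G (fst z) (snd z)"
  have [measurable]: "?G \<in> borel_measurable (N \<Otimes>\<^sub>M N')"
    using G by (simp add: case_prod_beta')
  have intG: "integrable (distr M N X \<Otimes>\<^sub>M distr M N' Y) ?G"
    unfolding joint using int by (simp add: integrable_distr_eq)
  have [measurable]: "(\<lambda>a. \<integral>y. ?G (a, y) \<partial>distr M N' Y) \<in> borel_measurable N"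
    using borel_measurable_integrable[OF integrable_fst'[OF intG]] by simp
  show "integrable M (\<lambda>\<omega>. \<integral>y. G (X \<omega>) y \<partial>distr M N' Y)"
    using integrable_fst'[OF intG] by (simp add: integrable_distr_eq)
  have "expectation (\<lambda>\<omega>. G (X \<omega>) (Y \<omega>)) = integral\<^sup>L (distr M N X \<Otimes>\<^sub>M distr M N' Y) ?G"
    unfolding joint by (simp add: integral_distr)
  also have "\<dots> = (\<integral>a. \<integral>y. ?G (a, y) \<partial>distr M N' Y \<partial>distr M N X)"
    by (rule integral_fst'[OF intG, symmetric])
  also have "\<dots> = expectation (\<lambda>\<omega>. \<integral>y. G (X \<omega>) y \<partial>distr M N' Y)"
    by (subst integral_distr) simp_all
  finally show "expectation (\<lambda>\<omega>. G (X \<omega>) (Y \<omega>)) = expectation (\<lambda>\<omega>. \<integral>y. G (X \<omega>) y \<partial>distr M N' Y)" .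
qed

text \<open>
  All random quantities of the iteration are continuous functions of almost surely bounded vectors,
  which makes them integrable.
\<close>
lemma (in prob_space) integrable_continuous_bounded:
  fixes Z :: "'a \<Rightarrow> 'b::euclidean_space" and k :: "'b \<Rightarrow> real"
  assumes [measurable]: "Z \<in> borel_measurable M"
    and bd: "AE \<omega> in M. norm (Z \<omega>) \<le> C" and k: "continuous_on UNIV k"
  shows "integrable M (\<lambda>\<omega>. k (Z \<omega>))"
proof -
  have [measurable]: "k \<in> borel_measurable borel"
    using k by (rule borel_measurable_continuous_onI)
  obtain D where D: "\<And>z. norm z \<le> C \<Longrightarrow> \<bar>k z\<bar> \<le> D"
    using continuous_bounded_on_cball[OF k, of C] by blast
  have "AE \<omega> in M. norm (k (Z \<omega>)) \<le> D"
    using bd by eventually_elim (use D in auto)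
  then show ?thesis by (rule integrable_const_bound) measurable
qed

section \<open>The residual feedback iteration\<close>

text \<open>
  The iterate with index \<open>t\<close> has used only the directions before time \<open>t\<close>, hence is independent of the
  direction drawn at time \<open>t\<close>.
\<close>
lemma residual_iterate_cong:
  assumes "\<And>s. s < t \<Longrightarrow> u s = v s"
  shows "residual_iterate f \<alpha> \<eta> x1 u t = residual_iterate f \<alpha> \<eta> x1 v t"
  using assms by (induction f \<alpha> \<eta> x1 u t rule: residual_iterate.induct) auto

lemma residual_iterate_measurable:
  assumes [measurable]: "f \<in> borel_measurable borel" and "{0..<t} \<subseteq> I"
  shows "(\<lambda>p. residual_iterate f \<alpha> \<eta> x1 p t) \<in> borel_measurable (PiM I (\<lambda>_. borel))"
  using assms(2)
proof (induction t rule: induct_nat_012)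
  case (ge2 t)
  have [measurable]: "(\<lambda>p. residual_iterate f \<alpha> \<eta> x1 p t) \<in> borel_measurable (PiM I (\<lambda>_. borel))"
    "(\<lambda>p. residual_iterate f \<alpha> \<eta> x1 p (Suc t)) \<in> borel_measurable (PiM I (\<lambda>_. borel))"
    using ge2.IH ge2.prems by (simp_all add: subset_iff)
  have [measurable]: "(\<lambda>p. p t) \<in> borel_measurable (PiM I (\<lambda>_. borel))"
    "(\<lambda>p. p (Suc t)) \<in> borel_measurable (PiM I (\<lambda>_. borel))"
    using ge2.prems by (auto intro!: measurable_component_singleton)
  show ?case unfolding residual_iterate.simps residual_gradient_def by measurable
qed auto

text \<open>
  The bound depends on \<open>t\<close> and may grow quickly; it serves integrability only.
\<close>
lemma residual_iterate_bounded:
  fixes f :: "real^'n \<Rightarrow> real"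
  assumes lip: "L-lipschitz_on UNIV f" and "\<alpha> > 0" "\<eta> > 0"
  shows "\<exists>C. \<forall>u. (\<forall>s<t. norm (u s) \<le> 1) \<longrightarrow> norm (residual_iterate f \<alpha> \<eta> x1 u t) \<le> C"
proof (induction t rule: induct_nat_012)
  case (ge2 t)
  obtain C where C: "\<And>u. \<forall>s<t. norm (u s) \<le> 1 \<Longrightarrow> norm (residual_iterate f \<alpha> \<eta> x1 u t) \<le> C"
    using ge2 by blast
  obtain D where D: "\<And>u. \<forall>s<Suc t. norm (u s) \<le> 1 \<Longrightarrow> norm (residual_iterate f \<alpha> \<eta> x1 u (Suc t)) \<le> D"
    using ge2 by blast
  have L: "L \<ge> 0" by (rule lipschitz_on_nonneg[OF lip])
  define B where "B = D + \<eta> * (real CARD('n) * (L * (D + \<alpha> + (C + \<alpha>)) / \<alpha>))"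
  have "norm (residual_iterate f \<alpha> \<eta> x1 u (Suc (Suc t))) \<le> B" if u: "\<forall>s<Suc (Suc t). norm (u s) \<le> 1" for u
  proof -
    define y z where "y = residual_iterate f \<alpha> \<eta> x1 u (Suc t)" and "z = residual_iterate f \<alpha> \<eta> x1 u t"
    define F where "F = f (y + \<alpha> *\<^sub>R u (Suc t)) - f (z + \<alpha> *\<^sub>R u t)"
    have un: "norm (u t) \<le> 1" "norm (u (Suc t)) \<le> 1" using u by auto
    have yz: "norm y \<le> D" "norm z \<le> C" unfolding y_def z_def using u by (auto intro!: C D)
    have "norm (y + \<alpha> *\<^sub>R u (Suc t)) \<le> D + \<alpha>" "norm (z + \<alpha> *\<^sub>R u t) \<le> C + \<alpha>"
    proof -
      have "norm (\<alpha> *\<^sub>R u (Suc t)) \<le> \<alpha>" "norm (\<alpha> *\<^sub>R u t) \<le> \<alpha>"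
        using un \<open>\<alpha> > 0\<close> by (auto intro: mult_left_le)
      then show "norm (y + \<alpha> *\<^sub>R u (Suc t)) \<le> D + \<alpha>" "norm (z + \<alpha> *\<^sub>R u t) \<le> C + \<alpha>"
        using yz norm_triangle_ineq[of y "\<alpha> *\<^sub>R u (Suc t)"] norm_triangle_ineq[of z "\<alpha> *\<^sub>R u t"]
        by linarith+
    qed
    then have "dist (y + \<alpha> *\<^sub>R u (Suc t)) (z + \<alpha> *\<^sub>R u t) \<le> D + \<alpha> + (C + \<alpha>)"
      unfolding dist_norm using norm_triangle_ineq4[of "y + \<alpha> *\<^sub>R u (Suc t)" "z + \<alpha> *\<^sub>R u t"] by linarith
    then have F: "\<bar>F\<bar> \<le> L * (D + \<alpha> + (C + \<alpha>))"
      unfolding F_def using lipschitz_onD[OF lip, of "y + \<alpha> *\<^sub>R u (Suc t)" "z + \<alpha> *\<^sub>R u t"] L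
      by (auto simp: dist_real_def intro: order_trans mult_left_mono)
    have "norm (residual_gradient f \<alpha> y (u (Suc t)) z (u t)) =
        real CARD('n) * (\<bar>F\<bar> / \<alpha>) * norm (u (Suc t))"
      using \<open>\<alpha> > 0\<close> by (simp add: residual_gradient_def F_def abs_mult)
    also have "\<dots> \<le> real CARD('n) * (\<bar>F\<bar> / \<alpha>) * 1"
      using un \<open>\<alpha> > 0\<close> by (intro mult_left_mono) auto
    also have "\<dots> \<le> real CARD('n) * (L * (D + \<alpha> + (C + \<alpha>)) / \<alpha>)"
      using F \<open>\<alpha> > 0\<close> by (auto intro!: mult_left_mono divide_right_mono)
    finally have "norm (\<eta> *\<^sub>R residual_gradient f \<alpha> y (u (Suc t)) z (u t)) \<le>
        \<eta> * (real CARD('n) * (L * (D + \<alpha> + (C + \<alpha>)) / \<alpha>))"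
      using mult_left_mono[of _ _ \<eta>] \<open>\<eta> > 0\<close> by (metis abs_of_pos less_imp_le norm_scaleR)
    then show ?thesis
      using yz norm_triangle_ineq4[of y "\<eta> *\<^sub>R residual_gradient f \<alpha> y (u (Suc t)) z (u t)"]
      by (simp add: B_def y_def z_def)
  qed
  then show ?case by blast
qed auto

lemma square_sum3_le: "(a + b - c)\<^sup>2 \<le> 3 * (a\<^sup>2 + b\<^sup>2 + c\<^sup>2)" for a b c :: real
proof -
  have "3 * (a\<^sup>2 + b\<^sup>2 + c\<^sup>2) - (a + b - c)\<^sup>2 = (a - b)\<^sup>2 + (a + c)\<^sup>2 + (b + c)\<^sup>2"
    by (simp add: power2_eq_square algebra_simps)
  then show ?thesis using zero_le_power2[of "a - b"] zero_le_power2[of "a + c"] zero_le_power2[of "b + c"]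
    by linarith
qed

locale residual_feedback = prob_space M
  for M :: "'w measure" +
  fixes f :: "real^'n \<Rightarrow> real" and L \<alpha> \<eta> :: real and x1 :: "real^'n"
    and u :: "nat \<Rightarrow> 'w \<Rightarrow> real^'n" and T :: nat
  assumes convex: "convex_on UNIV f"
    and lipschitz: "L-lipschitz_on UNIV f"
    and L_pos: "L > 0" and \<alpha>_pos: "\<alpha> > 0" and \<eta>_pos: "\<eta> > 0"
    and indep: "indep_vars (\<lambda>_. borel) u {0..T}"
    and unif: "\<And>t. t \<le> T \<Longrightarrow> distr M borel (u t) = uniform_sphere"
begin

definition x :: "nat \<Rightarrow> 'w \<Rightarrow> real^'n" where
  "x t \<omega> = residual_iterate f \<alpha> \<eta> x1 (\<lambda>s. u s \<omega>) t"

definition g :: "nat \<Rightarrow> 'w \<Rightarrow> real^'n" where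
  "g t \<omega> = residual_gradient f \<alpha> (x t \<omega>) (u t \<omega>) (x (t - 1) \<omega>) (u (t - 1) \<omega>)"

definition sphere_average :: "real^'n \<Rightarrow> real" where
  "sphere_average y = (\<integral>v. f (y + \<alpha> *\<^sub>R v) \<partial>uniform_sphere)"

lemma x_0: "x 0 \<omega> = x1" and x_1: "x (Suc 0) \<omega> = x1"
  by (simp_all add: x_def)

lemma x_Suc: "t \<ge> 1 \<Longrightarrow> x (Suc t) \<omega> = x t \<omega> - \<eta> *\<^sub>R g t \<omega>"
  by (cases t) (auto simp: x_def g_def)

lemma continuous_f: "continuous_on UNIV f"
  by (rule lipschitz_on_continuous_on[OF lipschitz])

lemma continuous_f_compose: "continuous_on A k \<Longrightarrow> continuous_on A (\<lambda>z. f (k z))"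
  by (rule continuous_on_compose2[OF continuous_f]) auto

lemma measurable_f [measurable]: "f \<in> borel_measurable borel"
  using continuous_f by (rule borel_measurable_continuous_onI)

lemma sphere_average_lipschitz: "L-lipschitz_on UNIV sphere_average"
  using sphere_average_lipschitz[OF lipschitz, of \<alpha>] by (simp add: sphere_average_def[abs_def])

lemma continuous_sphere_average_compose:
  "continuous_on A k \<Longrightarrow> continuous_on A (\<lambda>z. sphere_average (k z))"
  by (rule continuous_on_compose2[OF lipschitz_on_continuous_on[OF sphere_average_lipschitz]]) auto

lemma measurable_u: "t \<le> T \<Longrightarrow> u t \<in> borel_measurable M"
  using indep by (auto simp: indep_vars_def)

lemma AE_norm_u: "t \<le> T \<Longrightarrow> AE \<omega> in M. norm (u t \<omega>) = 1"
  by (rule AE_distrD[OF measurable_u]) (simp_all only: unif AE_uniform_sphere)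

lemma measurable_x:
  assumes "t \<le> Suc T"
  shows "x t \<in> borel_measurable M"
proof -
  have "(\<lambda>\<omega>. \<lambda>s\<in>{0..<t}. u s \<omega>) \<in> measurable M (PiM {0..<t} (\<lambda>_. borel))"
    using assms by (intro measurable_restrict measurable_u) auto
  from measurable_compose[OF this residual_iterate_measurable[OF measurable_f order_refl]]
  have "(\<lambda>\<omega>. residual_iterate f \<alpha> \<eta> x1 (\<lambda>s\<in>{0..<t}. u s \<omega>) t) \<in> borel_measurable M" .
  also have "(\<lambda>\<omega>. residual_iterate f \<alpha> \<eta> x1 (\<lambda>s\<in>{0..<t}. u s \<omega>) t) = x t"
    unfolding x_def by (intro ext residual_iterate_cong) auto
  finally show ?thesis .
qed

lemma AE_norm_x_bounded:
  assumes "t \<le> Suc T"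
  shows "\<exists>C. AE \<omega> in M. norm (x t \<omega>) \<le> C"
proof -
  obtain C where C: "\<And>v. \<forall>s<t. norm (v s) \<le> 1 \<Longrightarrow> norm (residual_iterate f \<alpha> \<eta> x1 v t) \<le> C"
    using residual_iterate_bounded[OF lipschitz \<alpha>_pos \<eta>_pos] by blast
  have "AE \<omega> in M. \<forall>s\<in>{..<t}. norm (u s \<omega>) = 1"
    using assms by (intro AE_finite_allI AE_norm_u) auto
  then have "AE \<omega> in M. norm (x t \<omega>) \<le> C"
    by eventually_elim (use C in \<open>auto simp: x_def\<close>)
  then show ?thesis ..
qed

lemma integrable_continuous_x:
  assumes "t \<le> Suc T" "continuous_on UNIV (k :: real^'n \<Rightarrow> real)"
  shows "integrable M (\<lambda>\<omega>. k (x t \<omega>))"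
  using AE_norm_x_bounded[OF assms(1)] assms
  by (auto intro: integrable_continuous_bounded measurable_x)

lemma integrable_continuous_state:
  fixes k :: "(real^'n) \<times> (real^'n) \<times> (real^'n) \<times> (real^'n) \<Rightarrow> real"
  assumes t: "t \<le> T" and k: "continuous_on UNIV k"
  shows "integrable M (\<lambda>\<omega>. k (x t \<omega>, u t \<omega>, x (t - 1) \<omega>, u (t - 1) \<omega>))"
proof -
  obtain C where C: "AE \<omega> in M. norm (x t \<omega>) \<le> C"
    using AE_norm_x_bounded[of t] t by auto
  obtain D where D: "AE \<omega> in M. norm (x (t - 1) \<omega>) \<le> D"
    using AE_norm_x_bounded[of "t - 1"] t by (meson diff_le_self le_SucI le_trans)
  have U: "AE \<omega> in M. norm (u t \<omega>) = 1" "AE \<omega> in M. norm (u (t - 1) \<omega>) = 1"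
    using t by (auto intro!: AE_norm_u)
  have "AE \<omega> in M. norm (x t \<omega>, u t \<omega>, x (t - 1) \<omega>, u (t - 1) \<omega>) \<le> C + (1 + (D + 1))"
    using C D U
  proof eventually_elim
    case (elim \<omega>)
    then show ?case
      using norm_Pair_le[of "x t \<omega>" "(u t \<omega>, x (t - 1) \<omega>, u (t - 1) \<omega>)"]
        norm_Pair_le[of "u t \<omega>" "(x (t - 1) \<omega>, u (t - 1) \<omega>)"]
        norm_Pair_le[of "x (t - 1) \<omega>" "u (t - 1) \<omega>"] by linarith
  qed
  moreover have "(\<lambda>\<omega>. (x t \<omega>, u t \<omega>, x (t - 1) \<omega>, u (t - 1) \<omega>)) \<in> borel_measurable M"
    using t by (intro borel_measurable_Pair measurable_x measurable_u) auto
  ultimately show ?thesis using k by (intro integrable_continuous_bounded) auto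
qed

text \<open>
  Conditioning on the past: \<open>Z\<close> is a function of the directions before time \<open>t\<close>, so in an expectation
  the direction \<open>u t\<close> may be averaged over the sphere with \<open>Z\<close> held fixed.
\<close>
lemma integrate_out_direction:
  assumes t: "t \<le> T" and F [measurable]: "F \<in> measurable (PiM {0..<t} (\<lambda>_. borel)) N"
    and Z: "\<And>\<omega>. Z \<omega> = F (\<lambda>s\<in>{0..<t}. u s \<omega>)"
    and G: "(\<lambda>(z, v). G z v) \<in> borel_measurable (N \<Otimes>\<^sub>M borel)"
    and int: "integrable M (\<lambda>\<omega>. G (Z \<omega>) (u t \<omega>))"
  shows "integrable M (\<lambda>\<omega>. \<integral>v. G (Z \<omega>) v \<partial>uniform_sphere)"
    and "expectation (\<lambda>\<omega>. G (Z \<omega>) (u t \<omega>) :: real) =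
      expectation (\<lambda>\<omega>. \<integral>v. G (Z \<omega>) v \<partial>uniform_sphere)"
proof -
  let ?P = "\<lambda>\<omega>. \<lambda>s\<in>{0..<t}. u s \<omega>" and ?Q = "\<lambda>\<omega>. \<lambda>s\<in>{t}. u s \<omega>"
  let ?B = "\<lambda>I. PiM I (\<lambda>_. borel) :: (nat \<Rightarrow> real^'n) measure"
  have PQ: "indep_var (?B {0..<t}) ?P (?B {t}) ?Q"
    using t by (intro indep_var_restrict[OF indep]) auto
  have [measurable]: "?P \<in> measurable M (?B {0..<t})" "?Q \<in> measurable M (?B {t})"
    using PQ by (auto dest: indep_var_rv1 indep_var_rv2)
  have [measurable]: "(\<lambda>q. q t) \<in> borel_measurable (?B {t})"
    by (rule measurable_component_singleton) simp
  have [measurable]: "u t \<in> borel_measurable M" by (rule measurable_u[OF t])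
  have "(\<lambda>(p, q). G (F p) (q t)) = (\<lambda>(z, v). G z v) \<circ> (\<lambda>(p, q). (F p, q t))"
    by auto
  moreover have "(\<lambda>(p, q). (F p, q t)) \<in> measurable (?B {0..<t} \<Otimes>\<^sub>M ?B {t}) (N \<Otimes>\<^sub>M borel)"
    by measurable
  ultimately have G': "(\<lambda>(p, q). G (F p) (q t)) \<in> borel_measurable (?B {0..<t} \<Otimes>\<^sub>M ?B {t})"
    using G by (auto intro: measurable_comp)
  have inner: "(\<integral>q. G (F (?P \<omega>)) (q t) \<partial>distr M (?B {t}) ?Q) = (\<integral>v. G (Z \<omega>) v \<partial>uniform_sphere)"
    if "\<omega> \<in> space M" for \<omega>
  proof -
    have "F (?P \<omega>) \<in> space N"
      using that by (auto intro!: measurable_space[OF F] measurable_space[of ?P M])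
    from measurable_compose[OF measurable_Pair1'[OF this] G]
    have [measurable]: "G (F (?P \<omega>)) \<in> borel_measurable borel" by simp
    have "(\<integral>q. G (F (?P \<omega>)) (q t) \<partial>distr M (?B {t}) ?Q) = (\<integral>\<omega>'. G (F (?P \<omega>)) (u t \<omega>') \<partial>M)"
      by (simp add: integral_distr)
    also have "\<dots> = (\<integral>v. G (F (?P \<omega>)) v \<partial>distr M borel (u t))"
      by (simp add: integral_distr)
    finally show ?thesis by (simp add: unif[OF t] Z)
  qed
  have int': "integrable M (\<lambda>\<omega>. G (F (?P \<omega>)) (?Q \<omega> t))"
    using int by (simp add: Z)
  note E = expectation_indep_iterated[where G = "\<lambda>p q. G (F p) (q t)", OF PQ G' int']
  show "integrable M (\<lambda>\<omega>. \<integral>v. G (Z \<omega>) v \<partial>uniform_sphere)"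
    using E(1) by (rule Bochner_Integration.integrable_cong[THEN iffD1, rotated -1]) (rule refl, erule inner)
  have "expectation (\<lambda>\<omega>. G (Z \<omega>) (u t \<omega>)) = expectation (\<lambda>\<omega>. G (F (?P \<omega>)) (?Q \<omega> t))"
    by (simp add: Z)
  also have "\<dots> = expectation (\<lambda>\<omega>. \<integral>q. G (F (?P \<omega>)) (q t) \<partial>distr M (?B {t}) ?Q)"
    by (rule E(2))
  also have "\<dots> = expectation (\<lambda>\<omega>. \<integral>v. G (Z \<omega>) v \<partial>uniform_sphere)"
    by (intro Bochner_Integration.integral_cong refl inner)
  finally show "expectation (\<lambda>\<omega>. G (Z \<omega>) (u t \<omega>)) =
      expectation (\<lambda>\<omega>. \<integral>v. G (Z \<omega>) v \<partial>uniform_sphere)" .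
qed

lemma x_eq_restrict:
  "s \<le> t \<Longrightarrow> x s \<omega> = residual_iterate f \<alpha> \<eta> x1 (\<lambda>r\<in>{0..<t}. u r \<omega>) s"
  unfolding x_def by (intro residual_iterate_cong) auto

lemma expectation_estimate_lower_bound:
  assumes t: "1 \<le> t" "t \<le> T"
  shows "expectation (\<lambda>\<omega>. f (x t \<omega>)) - f y - \<alpha> * L \<le> expectation (\<lambda>\<omega>. g t \<omega> \<bullet> (x t \<omega> - y))"
proof -
  define G :: "(real^'n) \<times> (real^'n) \<times> (real^'n) \<Rightarrow> real^'n \<Rightarrow> real" where
    "G z v = residual_gradient f \<alpha> (fst z) v (fst (snd z)) (snd (snd z)) \<bullet> (fst z - y)" for z v
  let ?S = "\<lambda>\<omega>. (x t \<omega>, x (t - 1) \<omega>, u (t - 1) \<omega>)"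
  have cG: "continuous_on UNIV (\<lambda>q. G (fst q, snd (snd q)) (fst (snd q)))"
    unfolding G_def residual_gradient_def divide_inverse
    by (intro continuous_intros continuous_f_compose)
  have "continuous_on UNIV (\<lambda>(z, v). G z v)"
    unfolding G_def residual_gradient_def divide_inverse case_prod_beta'
    by (intro continuous_intros continuous_f_compose)
  then have mG: "(\<lambda>(z, v). G z v) \<in> borel_measurable (borel \<Otimes>\<^sub>M borel)"
    unfolding borel_prod by (rule borel_measurable_continuous_onI)
  have iG: "integrable M (\<lambda>\<omega>. G (?S \<omega>) (u t \<omega>))"
    using integrable_continuous_state[OF t(2) cG] by simp
  let ?F = "\<lambda>p. (residual_iterate f \<alpha> \<eta> x1 p t, residual_iterate f \<alpha> \<eta> x1 p (t - 1), p (t - 1))"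
  have F: "?F \<in> borel_measurable (PiM {0..<t} (\<lambda>_. borel))"
    using t by (intro borel_measurable_Pair residual_iterate_measurable measurable_component_singleton)
      auto
  have S: "?S \<omega> = ?F (\<lambda>s\<in>{0..<t}. u s \<omega>)" for \<omega>
    using t by (auto intro!: x_eq_restrict)
  note E = integrate_out_direction[OF t(2) F S mG iG]
  have "expectation (\<lambda>\<omega>. f (x t \<omega>)) - f y - \<alpha> * L = expectation (\<lambda>\<omega>. f (x t \<omega>) - f y - \<alpha> * L)"
    using integrable_continuous_x[OF _ continuous_f, of t] t prob_space by simp
  also have "\<dots> \<le> expectation (\<lambda>\<omega>. \<integral>v. G (?S \<omega>) v \<partial>uniform_sphere)"
  proof (rule integral_mono[OF _ E(1)])
    show "integrable M (\<lambda>\<omega>. f (x t \<omega>) - f y - \<alpha> * L)"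
      using integrable_continuous_x[OF _ continuous_f, of t] t by simp
    fix \<omega>
    show "f (x t \<omega>) - f y - \<alpha> * L \<le> (\<integral>v. G (?S \<omega>) v \<partial>uniform_sphere)"
      using one_point_estimate_lower_bound[OF convex lipschitz \<alpha>_pos, of "x t \<omega>" y
          "f (x (t - 1) \<omega> + \<alpha> *\<^sub>R u (t - 1) \<omega>)"]
      by (simp add: G_def residual_gradient_def)
  qed
  also have "\<dots> = expectation (\<lambda>\<omega>. G (?S \<omega>) (u t \<omega>))"
    by (rule E(2)[symmetric])
  finally show ?thesis by (simp add: G_def g_def)
qed

lemma expectation_sphere_fluctuation:
  assumes c: "sphere_fourth_moment_constant c" and t: "t \<le> T"
  shows "expectation (\<lambda>\<omega>. (f (x t \<omega> + \<alpha> *\<^sub>R u t \<omega>) - sphere_average (x t \<omega>))\<^sup>2)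
    \<le> c * \<alpha>\<^sup>2 * L\<^sup>2 / CARD('n)"
proof -
  define G where "G z v = (f (z + \<alpha> *\<^sub>R v) - sphere_average z)\<^sup>2" for z v
  have cG: "continuous_on UNIV (\<lambda>q. G (fst q) (fst (snd q)))"
    unfolding G_def by (intro continuous_intros continuous_f_compose continuous_sphere_average_compose)
  have "continuous_on UNIV (\<lambda>(z, v). G z v)"
    unfolding G_def case_prod_beta'
    by (intro continuous_intros continuous_f_compose continuous_sphere_average_compose)
  then have mG: "(\<lambda>(z, v). G z v) \<in> borel_measurable (borel \<Otimes>\<^sub>M borel)"
    unfolding borel_prod by (rule borel_measurable_continuous_onI)
  have iG: "integrable M (\<lambda>\<omega>. G (x t \<omega>) (u t \<omega>))"
    using integrable_continuous_state[OF t cG] by simp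
  note E = integrate_out_direction[OF t residual_iterate_measurable[OF measurable_f order_refl]
      x_eq_restrict[OF order_refl] mG iG]
  have "expectation (\<lambda>\<omega>. G (x t \<omega>) (u t \<omega>)) = expectation (\<lambda>\<omega>. \<integral>v. G (x t \<omega>) v \<partial>uniform_sphere)"
    by (rule E(2))
  also have "\<dots> \<le> expectation (\<lambda>\<omega>. c * \<alpha>\<^sup>2 * L\<^sup>2 / CARD('n))"
  proof (rule integral_mono[OF E(1)])
    fix \<omega>
    have "(\<alpha> * L)-lipschitz_on UNIV (\<lambda>v. f (x t \<omega> + \<alpha> *\<^sub>R v))"
      using lipschitz_on_affine_shift[OF lipschitz \<alpha>_pos, of "x t \<omega>" 0] by simp
    from sphere_variance_le[OF c _ this] show "(\<integral>v. G (x t \<omega>) v \<partial>uniform_sphere) \<le> c * \<alpha>\<^sup>2 * L\<^sup>2 / CARD('n)"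
      using L_pos \<alpha>_pos by (simp add: G_def sphere_average_def power_mult_distrib mult.assoc)
  qed simp
  finally show ?thesis using prob_space by (simp add: G_def)
qed

lemma integrable_norm_g: "t \<le> T \<Longrightarrow> integrable M (\<lambda>\<omega>. (norm (g t \<omega>))\<^sup>2)"
proof -
  assume t: "t \<le> T"
  have "continuous_on UNIV (\<lambda>(a, b, c, d). (norm (residual_gradient f \<alpha> a b c d))\<^sup>2)"
    unfolding residual_gradient_def divide_inverse case_prod_beta'
    by (intro continuous_intros continuous_f_compose)
  from integrable_continuous_state[OF t this] show ?thesis by (simp add: g_def)
qed

lemma integrable_norm_step:
  "t \<le> T \<Longrightarrow> integrable M (\<lambda>\<omega>. (norm (x t \<omega> - x (t - 1) \<omega>))\<^sup>2)"
proof -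
  assume t: "t \<le> T"
  have "continuous_on UNIV (\<lambda>(a::real^'n, b::real^'n, c::real^'n, d::real^'n). (norm (a - c))\<^sup>2)"
    unfolding case_prod_beta' by (intro continuous_intros)
  from integrable_continuous_state[OF t this] show ?thesis by simp
qed

lemma integrable_inner_g: "t \<le> T \<Longrightarrow> integrable M (\<lambda>\<omega>. g t \<omega> \<bullet> (x t \<omega> - y))"
proof -
  assume t: "t \<le> T"
  have "continuous_on UNIV (\<lambda>(a, b, c, d). residual_gradient f \<alpha> a b c d \<bullet> (a - y))"
    unfolding residual_gradient_def divide_inverse case_prod_beta'
    by (intro continuous_intros continuous_f_compose)
  from integrable_continuous_state[OF t this] show ?thesis by (simp add: g_def)
qed

lemma integrable_sphere_fluctuation:
  "t \<le> T \<Longrightarrow> integrable M (\<lambda>\<omega>. (f (x t \<omega> + \<alpha> *\<^sub>R u t \<omega>) - sphere_average (x t \<omega>))\<^sup>2)"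
proof -
  assume t: "t \<le> T"
  have "continuous_on UNIV (\<lambda>(a, b, c::real^'n, d::real^'n). (f (a + \<alpha> *\<^sub>R b) - sphere_average a)\<^sup>2)"
    unfolding case_prod_beta'
    by (intro continuous_intros continuous_f_compose continuous_sphere_average_compose)
  from integrable_continuous_state[OF t this] show ?thesis by simp
qed

section \<open>Second moments and the convergence rate\<close>

text \<open>
  The difference of the two function values splits into the deviation of the current value from its
  sphere average, the change of the sphere average between the two iterates, and the deviation of
  the previous value.  The deviations have variance at most \<open>c * \<alpha>\<^sup>2 * L\<^sup>2 / d\<close>, and the sphere
  average is \<open>L\<close>-Lipschitz.
\<close>
lemma second_moment_le_step:
  fixes c :: real
  assumes c: "sphere_fourth_moment_constant c" and t: "1 \<le> t" "t \<le> T"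
  shows "expectation (\<lambda>\<omega>. (norm (g t \<omega>))\<^sup>2) \<le> 6 * c * real CARD('n) * L\<^sup>2 +
    3 * (real CARD('n))\<^sup>2 * L\<^sup>2 / \<alpha>\<^sup>2 * expectation (\<lambda>\<omega>. (norm (x t \<omega> - x (t - 1) \<omega>))\<^sup>2)"
proof -
  let ?d = "real CARD('n)"
  define A where "A t \<omega> = f (x t \<omega> + \<alpha> *\<^sub>R u t \<omega>) - sphere_average (x t \<omega>)" for t \<omega>
  define B where "B \<omega> = norm (x t \<omega> - x (t - 1) \<omega>)" for \<omega>
  have t': "t - 1 \<le> T" using t by simp
  have iA: "integrable M (\<lambda>\<omega>. (A t \<omega>)\<^sup>2)" "integrable M (\<lambda>\<omega>. (A (t - 1) \<omega>)\<^sup>2)"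
    unfolding A_def by (intro integrable_sphere_fluctuation t t')+
  have iB: "integrable M (\<lambda>\<omega>. (B \<omega>)\<^sup>2)"
    unfolding B_def by (intro integrable_norm_step t)
  have EA: "expectation (\<lambda>\<omega>. (A t \<omega>)\<^sup>2) \<le> c * \<alpha>\<^sup>2 * L\<^sup>2 / ?d"
    "expectation (\<lambda>\<omega>. (A (t - 1) \<omega>)\<^sup>2) \<le> c * \<alpha>\<^sup>2 * L\<^sup>2 / ?d"
    unfolding A_def by (intro expectation_sphere_fluctuation c t t')+
  have "expectation (\<lambda>\<omega>. (norm (g t \<omega>))\<^sup>2) \<le>
      expectation (\<lambda>\<omega>. 3 * ?d\<^sup>2 / \<alpha>\<^sup>2 * ((A t \<omega>)\<^sup>2 + L\<^sup>2 * (B \<omega>)\<^sup>2 + (A (t - 1) \<omega>)\<^sup>2))"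
  proof (rule integral_mono_AE)
    show "integrable M (\<lambda>\<omega>. (norm (g t \<omega>))\<^sup>2)" by (rule integrable_norm_g[OF t(2)])
    show "integrable M (\<lambda>\<omega>. 3 * ?d\<^sup>2 / \<alpha>\<^sup>2 * ((A t \<omega>)\<^sup>2 + L\<^sup>2 * (B \<omega>)\<^sup>2 + (A (t - 1) \<omega>)\<^sup>2))"
      using iA iB by simp
    show "AE \<omega> in M. (norm (g t \<omega>))\<^sup>2 \<le>
        3 * ?d\<^sup>2 / \<alpha>\<^sup>2 * ((A t \<omega>)\<^sup>2 + L\<^sup>2 * (B \<omega>)\<^sup>2 + (A (t - 1) \<omega>)\<^sup>2)"
      using AE_norm_u[OF t(2)]
    proof eventually_elim
      case (elim \<omega>)
      define D where "D = sphere_average (x t \<omega>) - sphere_average (x (t - 1) \<omega>)"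
      have "\<bar>D\<bar> \<le> L * B \<omega>"
        using lipschitz_onD[OF sphere_average_lipschitz, of "x t \<omega>" "x (t - 1) \<omega>"]
        by (simp add: D_def B_def dist_real_def dist_norm)
      then have D: "D\<^sup>2 \<le> L\<^sup>2 * (B \<omega>)\<^sup>2"
        by (metis abs_ge_zero power2_abs power_mono power_mult_distrib)
      have "(norm (g t \<omega>))\<^sup>2 = ?d\<^sup>2 / \<alpha>\<^sup>2 * (A t \<omega> + D - A (t - 1) \<omega>)\<^sup>2"
        using elim by (simp add: g_def residual_gradient_def A_def D_def power_mult_distrib power_divide)
      also have "\<dots> \<le> ?d\<^sup>2 / \<alpha>\<^sup>2 * (3 * ((A t \<omega>)\<^sup>2 + L\<^sup>2 * (B \<omega>)\<^sup>2 + (A (t - 1) \<omega>)\<^sup>2))"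
        using D square_sum3_le[of "A t \<omega>" D "A (t - 1) \<omega>"] by (intro mult_left_mono) auto
      finally show ?case by (simp only: mult_ac times_divide_eq_left times_divide_eq_right)
    qed
  qed
  also have "\<dots> = 3 * ?d\<^sup>2 / \<alpha>\<^sup>2 * (expectation (\<lambda>\<omega>. (A t \<omega>)\<^sup>2) + L\<^sup>2 * expectation (\<lambda>\<omega>. (B \<omega>)\<^sup>2)
      + expectation (\<lambda>\<omega>. (A (t - 1) \<omega>)\<^sup>2))"
    using iA iB by simp
  also have "\<dots> \<le> 3 * ?d\<^sup>2 / \<alpha>\<^sup>2 * (c * \<alpha>\<^sup>2 * L\<^sup>2 / ?d + L\<^sup>2 * expectation (\<lambda>\<omega>. (B \<omega>)\<^sup>2)
      + c * \<alpha>\<^sup>2 * L\<^sup>2 / ?d)"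
    using EA by (intro mult_left_mono add_mono order_refl) auto
  also have "\<dots> = 6 * c * ?d * L\<^sup>2 + 3 * ?d\<^sup>2 * L\<^sup>2 / \<alpha>\<^sup>2 * expectation (\<lambda>\<omega>. (B \<omega>)\<^sup>2)"
    using \<alpha>_pos by (simp add: field_simps power2_eq_square)
  finally show ?thesis by (simp add: B_def)
qed

text \<open>
  Consecutive iterates differ by \<open>\<eta>\<close> times the previous estimate, so the second moments satisfy
  \<open>E\<^sub>t \<le> K + E\<^sub>t\<^sub>-\<^sub>1 / 3\<close> with \<open>K = 6 c d L\<^sup>2\<close>, and stay below a fixed multiple \<open>3 K / 2\<close>.
  In the first round both iterates are the starting point and only \<open>K\<close> remains.
\<close>
lemma second_moment_bound:
  fixes c :: real
  assumes c: "sphere_fourth_moment_constant c"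
    and contraction: "3 * (real CARD('n))\<^sup>2 * L\<^sup>2 * \<eta>\<^sup>2 / \<alpha>\<^sup>2 \<le> 1 / 3"
    and "1 \<le> t" "t \<le> T"
  shows "expectation (\<lambda>\<omega>. (norm (g t \<omega>))\<^sup>2) \<le> 9 * c * real CARD('n) * L\<^sup>2"
  using assms(3,4)
proof (induction t rule: dec_induct)
  case base
  have "c > 0" using c by (simp add: sphere_fourth_moment_constant_def)
  then have "6 * c * real CARD('n) * L\<^sup>2 \<le> 9 * c * real CARD('n) * L\<^sup>2"
    by (intro mult_right_mono) auto
  then show ?case
    using second_moment_le_step[OF c order_refl base] by (simp add: x_0 x_1)
next
  case (step t)
  let ?E = "expectation (\<lambda>\<omega>. (norm (g t \<omega>))\<^sup>2)"
  have step_sq: "(norm (x (Suc t) \<omega> - x (Suc t - 1) \<omega>))\<^sup>2 = \<eta>\<^sup>2 * (norm (g t \<omega>))\<^sup>2" for \<omega>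
    using x_Suc[OF step.hyps(1)] by (simp add: power_mult_distrib)
  have "expectation (\<lambda>\<omega>. (norm (g (Suc t) \<omega>))\<^sup>2) \<le> 6 * c * real CARD('n) * L\<^sup>2 +
      3 * (real CARD('n))\<^sup>2 * L\<^sup>2 / \<alpha>\<^sup>2 * (\<eta>\<^sup>2 * ?E)"
    using second_moment_le_step[OF c _ step.prems] unfolding step_sq by simp
  also have "\<dots> = 6 * c * real CARD('n) * L\<^sup>2 + (3 * (real CARD('n))\<^sup>2 * L\<^sup>2 * \<eta>\<^sup>2 / \<alpha>\<^sup>2) * ?E"
    by (simp add: algebra_simps)
  also have "\<dots> \<le> 6 * c * real CARD('n) * L\<^sup>2 + 1 / 3 * ?E"
    by (intro add_left_mono mult_right_mono contraction) simp
  also have "\<dots> \<le> 6 * c * real CARD('n) * L\<^sup>2 + 1 / 3 * (9 * c * real CARD('n) * L\<^sup>2)"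
    using step.IH step.prems by (intro add_left_mono mult_left_mono) auto
  finally show ?case by simp
qed

lemma expectation_distance_step:
  assumes t: "1 \<le> t" "t \<le> T"
  shows "2 * \<eta> * expectation (\<lambda>\<omega>. g t \<omega> \<bullet> (x t \<omega> - y)) =
    expectation (\<lambda>\<omega>. (norm (x t \<omega> - y))\<^sup>2) - expectation (\<lambda>\<omega>. (norm (x (Suc t) \<omega> - y))\<^sup>2)
    + \<eta>\<^sup>2 * expectation (\<lambda>\<omega>. (norm (g t \<omega>))\<^sup>2)"
proof -
  have eq: "(norm (x (Suc t) \<omega> - y))\<^sup>2 =
      (norm (x t \<omega> - y))\<^sup>2 - 2 * \<eta> * (g t \<omega> \<bullet> (x t \<omega> - y)) + \<eta>\<^sup>2 * (norm (g t \<omega>))\<^sup>2" for \<omega>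
  proof -
    have "x (Suc t) \<omega> - y = (x t \<omega> - y) - \<eta> *\<^sub>R g t \<omega>" using x_Suc[OF t(1)] by simp
    then show ?thesis
      by (simp only: power2_norm_eq_inner) (simp add: inner_diff inner_commute power2_eq_square algebra_simps)
  qed
  have "integrable M (\<lambda>\<omega>. (norm (x t \<omega> - y))\<^sup>2)"
    using t by (intro integrable_continuous_x[where k="\<lambda>z. (norm (z - y))\<^sup>2"] continuous_intros) auto
  then show ?thesis
    unfolding eq using integrable_inner_g[OF t(2)] integrable_norm_g[OF t(2)] by simp
qed

text \<open>
  The squared distances to \<open>y\<close> telescope; each round contributes the bias \<open>\<alpha> * L\<close> of the smoothing and the
  second-order term of the step.
\<close>
lemma sum_optimality_gap_le:
  assumes G: "\<And>t. 1 \<le> t \<Longrightarrow> t \<le> T \<Longrightarrow> expectation (\<lambda>\<omega>. (norm (g t \<omega>))\<^sup>2) \<le> G" and T: "T \<ge> 1"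
  shows "(\<Sum>t=1..T. expectation (\<lambda>\<omega>. f (x t \<omega>) - f y)) \<le>
    (norm (x1 - y))\<^sup>2 / (2 * \<eta>) + T * (\<eta> * G / 2 + \<alpha> * L)"
proof -
  define D where "D t = expectation (\<lambda>\<omega>. (norm (x t \<omega> - y))\<^sup>2)" for t
  have step: "expectation (\<lambda>\<omega>. f (x t \<omega>) - f y) \<le>
      (D t - D (Suc t)) / (2 * \<eta>) + (\<eta> * G / 2 + \<alpha> * L)" if t: "t \<in> {1..T}" for t
  proof -
    have t': "1 \<le> t" "t \<le> T" using t by auto
    have "expectation (\<lambda>\<omega>. f (x t \<omega>) - f y) = expectation (\<lambda>\<omega>. f (x t \<omega>)) - f y"
      using integrable_continuous_x[OF _ continuous_f, of t] t' prob_space by simp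
    also have "\<dots> \<le> expectation (\<lambda>\<omega>. g t \<omega> \<bullet> (x t \<omega> - y)) + \<alpha> * L"
      using expectation_estimate_lower_bound[OF t', of y] by simp
    also have "expectation (\<lambda>\<omega>. g t \<omega> \<bullet> (x t \<omega> - y)) =
        (D t - D (Suc t) + \<eta>\<^sup>2 * expectation (\<lambda>\<omega>. (norm (g t \<omega>))\<^sup>2)) / (2 * \<eta>)"
      using expectation_distance_step[OF t', of y] \<eta>_pos by (simp add: D_def field_simps)
    also have "\<dots> \<le> (D t - D (Suc t) + \<eta>\<^sup>2 * G) / (2 * \<eta>)"
      using G[OF t'] \<eta>_pos by (intro divide_right_mono add_left_mono mult_left_mono) auto
    also have "\<dots> = (D t - D (Suc t)) / (2 * \<eta>) + \<eta> * G / 2"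
      using \<eta>_pos by (simp add: field_simps power2_eq_square)
    finally show ?thesis by simp
  qed
  have "(\<Sum>t=1..T. expectation (\<lambda>\<omega>. f (x t \<omega>) - f y)) \<le>
      (\<Sum>t=1..T. (D t - D (Suc t)) / (2 * \<eta>) + (\<eta> * G / 2 + \<alpha> * L))"
    by (intro sum_mono step)
  also have "\<dots> = (\<Sum>t=1..T. D t - D (Suc t)) / (2 * \<eta>) + T * (\<eta> * G / 2 + \<alpha> * L)"
    by (simp add: sum.distrib sum_divide_distrib)
  also have "(\<Sum>t=1..T. D t - D (Suc t)) = D 1 - D (Suc T)"
    using sum_Suc_diff[of 1 T "\<lambda>t. - D t"] T by simp
  also have "(D 1 - D (Suc T)) / (2 * \<eta>) \<le> (norm (x1 - y))\<^sup>2 / (2 * \<eta>)"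
    using \<eta>_pos prob_space by (intro divide_right_mono) (auto simp: D_def x_1)
  finally show ?thesis by simp
qed

end

theorem theorem5:
  fixes f :: "real^'n \<Rightarrow> real"
    and x1 xs :: "real^'n"
    and L0 c0 \<alpha> \<eta> :: real
    and T :: nat
    and M :: "'w measure"
    and u :: "nat \<Rightarrow> 'w \<Rightarrow> real^'n"
  assumes c0: "sphere_fourth_moment_constant c0"
    and convex: "convex_on UNIV f"
    and L0: "L0 > 0"
    and lipschitz: "L0-lipschitz_on UNIV f"
    and minimizer: "\<And>x. f xs \<le> f x"
    and T: "T \<ge> 1"
    and alpha: "\<alpha> = sqrt (real CARD('n) / real T)"
    and eta: "\<eta> = 1 / (3 * sqrt (real CARD('n) * real T) * L0)"
    and prob: "prob_space M"
    and indep: "prob_space.indep_vars M (\<lambda>_. borel) u {0..T}"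
    and unif: "\<And>t. t \<le> T \<Longrightarrow> distr M borel (u t) = uniform_sphere"
  shows "(1 / real T) * (\<Sum>t=1..T. \<integral>\<omega>. (f (residual_iterate f \<alpha> \<eta> x1 (\<lambda>s. u s \<omega>) t) - f xs) \<partial>M)
    \<le> 3 * (norm (x1 - xs))\<^sup>2 * sqrt (real CARD('n)) * L0 / sqrt (real T)
      + 4 * c0 * L0 * sqrt (real CARD('n)) / sqrt (real T)
      + sqrt (real CARD('n)) * L0 / sqrt (real T)"
proof -
  define d where "d = real CARD('n)"
  define a b where "a = sqrt d" and "b = sqrt (real T)"
  have ab: "a > 0" "b > 0" "a\<^sup>2 = d" "b\<^sup>2 = real T"
    using T by (auto simp: a_def b_def d_def)
  have \<alpha>: "\<alpha> = a / b" and \<eta>: "\<eta> = 1 / (3 * (a * b) * L0)"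
    unfolding alpha eta a_def b_def d_def by (simp_all add: real_sqrt_divide real_sqrt_mult)
  interpret residual_feedback M f L0 \<alpha> \<eta> x1 u T
    using assms ab L0 unfolding residual_feedback_def residual_feedback_axioms_def
    by (auto simp: \<alpha> \<eta>)
  have c0_pos: "c0 > 0" using c0 by (simp add: sphere_fourth_moment_constant_def)
  \<comment> \<open>The step size and the smoothing parameter are balanced so that the recursion contracts by 1/3.\<close>
  have "3 * d\<^sup>2 * L0\<^sup>2 * \<eta>\<^sup>2 / \<alpha>\<^sup>2 = 1 / 3"
    unfolding \<alpha> \<eta> ab(3)[symmetric] using ab(1,2) L0 by (simp add: field_simps power2_eq_square)
  then have G: "expectation (\<lambda>\<omega>. (norm (g t \<omega>))\<^sup>2) \<le> 9 * c0 * d * L0\<^sup>2" if "1 \<le> t" "t \<le> T" for t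
    using second_moment_bound[OF c0 _ that] by (simp add: d_def)
  have "(1 / real T) * (\<Sum>t=1..T. \<integral>\<omega>. (f (x t \<omega>) - f xs) \<partial>M) \<le>
      (1 / real T) * ((norm (x1 - xs))\<^sup>2 / (2 * \<eta>) + T * (\<eta> * (9 * c0 * d * L0\<^sup>2) / 2 + \<alpha> * L0))"
    using T by (intro mult_left_mono sum_optimality_gap_le G) auto
  also have "\<dots> = 3 / 2 * ((norm (x1 - xs))\<^sup>2 * a * L0 / b) + 3 / 2 * (c0 * L0 * a / b) + a * L0 / b"
    unfolding \<alpha> \<eta> ab(3,4)[symmetric] using ab(1,2) L0 by (simp add: field_simps power2_eq_square)
  also have "\<dots> \<le> 3 * ((norm (x1 - xs))\<^sup>2 * a * L0 / b) + 4 * (c0 * L0 * a / b) + a * L0 / b"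
    using ab L0 c0_pos by (intro add_mono mult_right_mono order_refl) auto
  finally show ?thesis by (simp add: x_def a_def b_def d_def mult_ac)
qed

end
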